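(* Let $k\ge3$ and $\boldsymbol{\lambda}=(\lambda_1,\dots,\lambda_k)\in(0,\infty)^k$, with $\lambda_{\min}=\min_j\lambda_j$ and $\lambda_{\max}=\max_j\lambda_j$. If $$8\,\lambda_{\max}^2\le\big[(k-1)^2+4\big]\lambda_{\min}^2,$$ then the generalized helicoid $\mathcal{H}_{\boldsymbol{\lambda}}$ is stable.
   Context: For $\boldsymbol{\lambda}\in(0,\infty)^k$, the generalized helicoid $\mathcal{H}_{\boldsymbol{\lambda}}\subset\mathbb{C}^k\times\mathbb{R}\cong\mathbb{R}^{2k+1}$ is the $(k+1)$-dimensional minimal submanifold parametrized by $(u_1,\dots,u_k,s)\mapsto(u_1e^{i\lambda_1s},\dots,u_ke^{i\lambda_ks},s)$, $(u,s)\in\mathbb{R}^k\times\mathbb{R}$. The second variation of area in the direction of a smooth compactly supported normal vector field $V$ on a minimal submanifold $M$ of Euclidean space is $$Q(V,V)=\int_{M}\Big(\sum_{a}|\nabla^\perp_{E_a}V|^2-\sum_{a,b}\langle \mathrm{II}(E_a,E_b),V\rangle^2\Big)\,d\mu_M,$$ where $\{E_a\}$ is any local orthonormal tangent frame, $\nabla^\perp$ is the normal connection, and $\mathrm{II}$ is the second fundamental form. $M$ is stable if $Q(V,V)\ge0$ for every such $V$. *)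

theory Defs
  imports "HOL-Analysis.Analysis"
begin

section \<open>Smooth maps\<close>

primrec Ck :: "nat \<Rightarrow> ('a::real_normed_vector \<Rightarrow> 'b::real_normed_vector) \<Rightarrow> bool" where
  "Ck 0 f \<longleftrightarrow> continuous_on UNIV f"
| "Ck (Suc n) f \<longleftrightarrow>
     (\<forall>x. f differentiable (at x)) \<and> (\<forall>v. Ck n (\<lambda>x. frechet_derivative f (at x) v))"

definition smooth :: "('a::real_normed_vector \<Rightarrow> 'b::real_normed_vector) \<Rightarrow> bool" where
  "smooth f \<longleftrightarrow> (\<forall>n. Ck n f)"


section \<open>Geometry of a parametrized submanifold\<close>

text \<open>
  A submanifold with a global parametrization \<open>F\<close> is handled through \<open>F\<close>, an injective immersion
  from one Euclidean space into another.  Tangent vectors at \<open>F x\<close> are written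
  \<open>frechet_derivative F (at x) v\<close>, and vector fields on the submanifold are maps \<open>V\<close> on the
  parameter space, with \<open>V x\<close> attached at the point \<open>F x\<close>.  In particular, smoothness and
  compactness of the support are those in the parameter space.
\<close>

definition tangent_space :: "('a::euclidean_space \<Rightarrow> 'b::euclidean_space) \<Rightarrow> 'a \<Rightarrow> 'b set" where
  "tangent_space F x = range (frechet_derivative F (at x))"

definition normal_subspace :: "('a::euclidean_space \<Rightarrow> 'b::euclidean_space) \<Rightarrow> 'a \<Rightarrow> 'b set" where
  "normal_subspace F x = (tangent_space F x)\<^sup>\<bottom>"

definition orth_proj :: "'b::euclidean_space set \<Rightarrow> 'b \<Rightarrow> 'b" where
  "orth_proj S z = (THE p. p \<in> S \<and> z - p \<in> S\<^sup>\<bottom>)"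

definition normal_deriv ::
  "('a::euclidean_space \<Rightarrow> 'b::euclidean_space) \<Rightarrow> ('a \<Rightarrow> 'b) \<Rightarrow> 'a \<Rightarrow> 'a \<Rightarrow> 'b" where
  "normal_deriv F V x v = orth_proj (normal_subspace F x) (frechet_derivative V (at x) v)"

text \<open>
  \<open>second_form F x v w\<close> is \<open>II\<close> at \<open>F x\<close> on the pair of tangent vectors with coordinates \<open>v\<close> and
  \<open>w\<close>: the normal part of the derivative, in direction \<open>v\<close>, of the tangent field
  \<open>y \<mapsto> frechet_derivative F (at y) w\<close>.
\<close>

definition second_form ::
  "('a::euclidean_space \<Rightarrow> 'b::euclidean_space) \<Rightarrow> 'a \<Rightarrow> 'a \<Rightarrow> 'a \<Rightarrow> 'b" where
  "second_form F x v w =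
     orth_proj (normal_subspace F x)
       (frechet_derivative (\<lambda>y. frechet_derivative F (at y) w) (at x) v)"

text \<open>
  The set \<open>Basis\<close> of the parameter space only serves as an index set of the right cardinality:
  the vectors \<open>frechet_derivative F (at x) (e a)\<close>, \<open>a \<in> Basis\<close>, are an orthonormal basis of the
  tangent space.
\<close>

definition tangent_frame ::
  "('a::euclidean_space \<Rightarrow> 'b::euclidean_space) \<Rightarrow> 'a \<Rightarrow> ('a \<Rightarrow> 'a) \<Rightarrow> bool" where
  "tangent_frame F x e \<longleftrightarrow>
     (\<forall>a\<in>Basis. \<forall>b\<in>Basis.
        frechet_derivative F (at x) (e a) \<bullet> frechet_derivative F (at x) (e b) = (if a = b then 1 else 0))"

definition is_minimal :: "('a::euclidean_space \<Rightarrow> 'b::euclidean_space) \<Rightarrow> bool" where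
  "is_minimal F \<longleftrightarrow>
     (\<forall>x e. tangent_frame F x e \<longrightarrow> (\<Sum>a\<in>Basis. second_form F x (e a) (e a)) = 0)"

text \<open>Leibniz formula for the determinant of the first fundamental form.\<close>

definition gram_det :: "('a::euclidean_space \<Rightarrow> 'b::euclidean_space) \<Rightarrow> 'a \<Rightarrow> real" where
  "gram_det F x =
     (\<Sum>p | p permutes (Basis :: 'a set). of_int (sign p) *
        (\<Prod>a\<in>Basis. frechet_derivative F (at x) a \<bullet> frechet_derivative F (at x) (p a)))"

definition normal_field ::
  "('a::euclidean_space \<Rightarrow> 'b::euclidean_space) \<Rightarrow> ('a \<Rightarrow> 'b) \<Rightarrow> bool" where
  "normal_field F V \<longleftrightarrow> (\<forall>x. V x \<in> normal_subspace F x)"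

definition second_variation_integrand ::
  "('a::euclidean_space \<Rightarrow> 'b::euclidean_space) \<Rightarrow> ('a \<Rightarrow> 'b) \<Rightarrow> 'a \<Rightarrow> ('a \<Rightarrow> 'a) \<Rightarrow> real" where
  "second_variation_integrand F V x e =
     (\<Sum>a\<in>Basis. (norm (normal_deriv F V x (e a)))\<^sup>2)
     - (\<Sum>a\<in>Basis. \<Sum>b\<in>Basis. (second_form F x (e a) (e b) \<bullet> V x)\<^sup>2)"

text \<open>
  The integral over the submanifold, pulled back to the parameter space, where the Riemannian
  measure has density \<open>sqrt (gram_det F x)\<close>.  The choice of frame is immaterial and frames exist,
  see \<open>second_variation_integrand_frame_indep\<close> and \<open>ex_tangent_frame\<close> below.
\<close>

definition second_variation ::
  "('a::euclidean_space \<Rightarrow> 'b::euclidean_space) \<Rightarrow> ('a \<Rightarrow> 'b) \<Rightarrow> real" where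
  "second_variation F V =
     (LINT x|lborel.
        second_variation_integrand F V x (SOME e. tangent_frame F x e) * sqrt (gram_det F x))"

definition stable_immersion :: "('a::euclidean_space \<Rightarrow> 'b::euclidean_space) \<Rightarrow> bool" where
  "stable_immersion F \<longleftrightarrow>
     (\<forall>V. smooth V \<and> compact (closure {x. V x \<noteq> 0}) \<and> normal_field F V
        \<longrightarrow> second_variation F V \<ge> 0)"


section \<open>Generalized helicoids\<close>

definition helicoid :: "real ^ 'k \<Rightarrow> (real ^ 'k) \<times> real \<Rightarrow> (complex ^ 'k) \<times> real" where
  "helicoid lam = (\<lambda>(u, s). (\<chi> j. of_real (u $ j) * exp (\<i> * of_real (lam $ j * s)), s))"


section \<open>Independence of the frame\<close>

lemma orth_proj_unique:
  assumes "subspace S" "p \<in> S" "z - p \<in> S\<^sup>\<bottom>"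
  shows "orth_proj S z = p"
  unfolding orth_proj_def
proof (rule the_equality)
  show "p \<in> S \<and> z - p \<in> S\<^sup>\<bottom>" using assms by simp
next
  fix q assume q: "q \<in> S \<and> z - q \<in> S\<^sup>\<bottom>"
  then have "p - q \<in> S" using assms by (simp add: subspace_diff)
  moreover have "(z - q) - (z - p) \<in> S\<^sup>\<bottom>"
    using q assms(3) subspace_diff[OF subspace_orthogonal_comp] by blast
  ultimately have "(p - q) \<bullet> (p - q) = 0"
    by (auto simp: orthogonal_comp_def orthogonal_def)
  then show "q = p" by simp
qed

lemma orth_proj_works:
  assumes "subspace S"
  shows "orth_proj S z \<in> S" "z - orth_proj S z \<in> S\<^sup>\<bottom>"
proof -
  have "z \<in> S + S\<^sup>\<bottom>" using subspace_sum_orthogonal_comp[OF assms] by simp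
  then obtain p q where pq: "z = p + q" "p \<in> S" "q \<in> S\<^sup>\<bottom>" by (rule set_plus_elim)
  then have "orth_proj S z = p" by (intro orth_proj_unique assms) auto
  with pq show "orth_proj S z \<in> S" "z - orth_proj S z \<in> S\<^sup>\<bottom>" by auto
qed

lemma linear_orth_proj:
  assumes "subspace S"
  shows "linear (orth_proj S)"
proof (rule linearI)
  fix x y
  have "(x - orth_proj S x) + (y - orth_proj S y) \<in> S\<^sup>\<bottom>"
    by (intro subspace_add subspace_orthogonal_comp orth_proj_works assms)
  then show "orth_proj S (x + y) = orth_proj S x + orth_proj S y"
    by (intro orth_proj_unique assms subspace_add orth_proj_works) (auto simp: algebra_simps)
next
  fix c :: real and x
  have "c *\<^sub>R (x - orth_proj S x) \<in> S\<^sup>\<bottom>"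
    by (intro subspace_scale subspace_orthogonal_comp orth_proj_works assms)
  then show "orth_proj S (c *\<^sub>R x) = c *\<^sub>R orth_proj S x"
    by (intro orth_proj_unique assms subspace_scale orth_proj_works) (auto simp: algebra_simps)
qed

lemma subspace_normal_subspace: "subspace (normal_subspace F x)"
  by (simp add: normal_subspace_def subspace_orthogonal_comp)

lemma orthonormal_family_expand:
  fixes A :: "'a::euclidean_space \<Rightarrow> 'b::euclidean_space" and e :: "'a \<Rightarrow> 'a"
  assumes A: "linear A" "inj A"
    and e: "\<forall>a\<in>Basis. \<forall>b\<in>Basis. A (e a) \<bullet> A (e b) = (if a = b then 1 else 0)"
  shows "v = (\<Sum>a\<in>Basis. (A v \<bullet> A (e a)) *\<^sub>R e a)"
proof -
  let ?E = "e ` (Basis :: 'a set)"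
  have inj: "inj_on e Basis"
  proof (rule inj_onI)
    fix a b :: 'a assume *: "a \<in> Basis" "b \<in> Basis" "e a = e b"
    then show "a = b" using e by (metis zero_neq_one)
  qed
  have coeff: "A (\<Sum>a\<in>Basis. c a *\<^sub>R e a) \<bullet> A (e b) = c b" if "b \<in> Basis" for c b
  proof -
    have "A (\<Sum>a\<in>Basis. c a *\<^sub>R e a) \<bullet> A (e b) = (\<Sum>a\<in>Basis. c a * (A (e a) \<bullet> A (e b)))"
      using A(1) by (simp add: linear_sum linear_cmul inner_sum_left)
    also have "\<dots> = (\<Sum>a\<in>Basis. if a = b then c a else 0)"
      by (rule sum.cong) (use e that in auto)
    also have "\<dots> = c b" using that by simp
    finally show ?thesis .
  qed
  have "independent ?E"
  proof (rule independent_if_scalars_zero)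
    fix f x assume f: "(\<Sum>x\<in>?E. f x *\<^sub>R x) = 0" and x: "x \<in> ?E"
    then obtain b where b: "b \<in> Basis" "x = e b" by auto
    have "(\<Sum>a\<in>Basis. f (e a) *\<^sub>R e a) = 0"
      using f by (simp add: sum.reindex[OF inj])
    then show "f x = 0" using coeff[OF b(1), of "\<lambda>a. f (e a)"] b(2) A(1) by (simp add: linear_0)
  qed simp
  moreover have "card ?E = DIM('a)" by (simp add: card_image inj)
  ultimately have "span ?E = UNIV"
    using card_eq_dim[of ?E UNIV] by auto
  then have "v \<in> span ?E" by simp
  then obtain f where "v = (\<Sum>x\<in>?E. f x *\<^sub>R x)"
    by (auto simp: span_finite)
  then have v: "v = (\<Sum>a\<in>Basis. f (e a) *\<^sub>R e a)"
    by (simp add: sum.reindex[OF inj])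
  have "f (e b) = A v \<bullet> A (e b)" if "b \<in> Basis" for b
    using coeff[OF that, of "\<lambda>a. f (e a)"] v by simp
  then have "(\<Sum>a\<in>Basis. (A v \<bullet> A (e a)) *\<^sub>R e a) = (\<Sum>a\<in>Basis. f (e a) *\<^sub>R e a)"
    by (intro sum.cong) auto
  also have "\<dots> = v" using v by (rule sym)
  finally show ?thesis by (rule sym)
qed

lemma trace_frame_indep:
  fixes A :: "'a::euclidean_space \<Rightarrow> 'b::euclidean_space"
    and e e' :: "'a \<Rightarrow> 'a" and B :: "'a \<Rightarrow> 'a \<Rightarrow> 'c::real_vector"
  assumes A: "linear A" "inj A"
    and e: "\<forall>a\<in>Basis. \<forall>b\<in>Basis. A (e a) \<bullet> A (e b) = (if a = b then 1 else 0)"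
    and e': "\<forall>a\<in>Basis. \<forall>b\<in>Basis. A (e' a) \<bullet> A (e' b) = (if a = b then 1 else 0)"
    and B1: "\<And>w. linear (\<lambda>v. B v w)" and B2: "\<And>v. linear (B v)"
  shows "(\<Sum>a\<in>Basis. B (e a) (e a)) = (\<Sum>a\<in>Basis. B (e' a) (e' a))"
proof -
  let ?o = "\<lambda>a b. A (e a) \<bullet> A (e' b)"
  have "(\<Sum>a\<in>Basis. B (e a) (e a)) = (\<Sum>a\<in>Basis. \<Sum>b\<in>Basis. ?o a b *\<^sub>R B (e' b) (e a))"
  proof (rule sum.cong[OF refl])
    fix a :: 'a
    have "B (e a) (e a) = B (\<Sum>b\<in>Basis. ?o a b *\<^sub>R e' b) (e a)"
      using orthonormal_family_expand[OF A e', of "e a"] by simp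
    also have "\<dots> = (\<Sum>b\<in>Basis. ?o a b *\<^sub>R B (e' b) (e a))"
      using linear_sum[OF B1, of "\<lambda>b. ?o a b *\<^sub>R e' b" Basis "e a"] by (simp add: linear_cmul[OF B1])
    finally show "B (e a) (e a) = (\<Sum>b\<in>Basis. ?o a b *\<^sub>R B (e' b) (e a))" .
  qed
  also have "\<dots> = (\<Sum>b\<in>Basis. \<Sum>a\<in>Basis. ?o a b *\<^sub>R B (e' b) (e a))"
    by (rule sum.swap)
  also have "\<dots> = (\<Sum>b\<in>Basis. B (e' b) (e' b))"
  proof (rule sum.cong[OF refl])
    fix b :: 'a
    have "B (e' b) (e' b) = B (e' b) (\<Sum>a\<in>Basis. ?o a b *\<^sub>R e a)"
      using orthonormal_family_expand[OF A e, of "e' b"] by (simp add: inner_commute)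
    also have "\<dots> = (\<Sum>a\<in>Basis. ?o a b *\<^sub>R B (e' b) (e a))"
      by (simp add: linear_sum[OF B2] linear_cmul[OF B2])
    finally show "(\<Sum>a\<in>Basis. ?o a b *\<^sub>R B (e' b) (e a)) = B (e' b) (e' b)" by simp
  qed
  finally show ?thesis .
qed

lemma smooth_differentiable:
  assumes "smooth f"
  shows "f differentiable (at x)"
    and "smooth (\<lambda>y. frechet_derivative f (at y) v)"
proof -
  have "Ck (Suc n) f" for n using assms unfolding smooth_def by blast
  then have *: "f differentiable (at x)" "Ck n (\<lambda>y. frechet_derivative f (at y) v)" for n x v
    unfolding Ck.simps by blast+
  show "f differentiable (at x)" by (rule *)
  show "smooth (\<lambda>y. frechet_derivative f (at y) v)" unfolding smooth_def using * by blast
qed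

lemma linear_frechet_derivative_smooth:
  "smooth f \<Longrightarrow> linear (frechet_derivative f (at x))"
  by (simp add: linear_frechet_derivative smooth_differentiable)

lemma linear_normal_deriv: "smooth V \<Longrightarrow> linear (normal_deriv F V x)"
  unfolding normal_deriv_def
  using linear_compose[OF linear_frechet_derivative_smooth linear_orth_proj[OF subspace_normal_subspace]]
  by (simp add: o_def)

lemma linear_second_form:
  assumes F: "smooth F"
  shows "linear (\<lambda>v. second_form F x v w)" and "linear (second_form F x v)"
proof -
  note P = linear_orth_proj[OF subspace_normal_subspace, of F x]
  show "linear (\<lambda>v. second_form F x v w)"
    unfolding second_form_def
    using linear_compose[OF linear_frechet_derivative_smooth[OF smooth_differentiable(2)[OF F]] P]
    by (simp add: o_def)
  let ?D = "\<lambda>w y. frechet_derivative F (at y) w"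
  have D: "(?D w has_derivative frechet_derivative (?D w) (at x)) (at x)" for w
    by (rule frechet_derivative_works[THEN iffD1, OF smooth_differentiable(1)[OF smooth_differentiable(2)[OF F]]])
  have lin: "linear (frechet_derivative F (at y))" for y
    by (rule linear_frechet_derivative_smooth[OF F])
  have add: "frechet_derivative (?D (w + w')) (at x) v
      = frechet_derivative (?D w) (at x) v + frechet_derivative (?D w') (at x) v" for w w'
  proof -
    have "(?D (w + w') has_derivative
        (\<lambda>v. frechet_derivative (?D w) (at x) v + frechet_derivative (?D w') (at x) v)) (at x)"
      using has_derivative_add[OF D[of w] D[of w']] by (simp add: linear_add[OF lin])
    from fun_cong[OF frechet_derivative_at[OF this], of v] show ?thesis by (rule sym)
  qed
  have scale: "frechet_derivative (?D (c *\<^sub>R w)) (at x) v = c *\<^sub>R frechet_derivative (?D w) (at x) v"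
    for c w
  proof -
    have "(?D (c *\<^sub>R w) has_derivative (\<lambda>v. c *\<^sub>R frechet_derivative (?D w) (at x) v)) (at x)"
      using has_derivative_scaleR_right[OF D[of w], of c] by (simp add: linear_cmul[OF lin])
    from fun_cong[OF frechet_derivative_at[OF this], of v] show ?thesis by (rule sym)
  qed
  show "linear (second_form F x v)"
    unfolding second_form_def
    by (rule linearI) (simp_all add: add scale linear_add[OF P] linear_cmul[OF P])
qed

proposition second_variation_integrand_frame_indep:
  assumes F: "smooth F" and V: "smooth V"
    and imm: "inj (frechet_derivative F (at x))"
    and e: "tangent_frame F x e" and e': "tangent_frame F x e'"
  shows "second_variation_integrand F V x e = second_variation_integrand F V x e'"
proof -
  note lin = linear_frechet_derivative_smooth[OF F, of x]
  note ee = e[unfolded tangent_frame_def] e'[unfolded tangent_frame_def]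
  note tr = trace_frame_indep[OF lin imm ee]
  note N = linear_normal_deriv[OF V, of F x]
  note S = linear_second_form[OF F]
  have 1: "(\<Sum>a\<in>Basis. (norm (normal_deriv F V x (e a)))\<^sup>2)
      = (\<Sum>a\<in>Basis. (norm (normal_deriv F V x (e' a)))\<^sup>2)"
    unfolding power2_norm_eq_inner
    using tr[of "\<lambda>v w. normal_deriv F V x v \<bullet> normal_deriv F V x w"]
    by (simp add: linear_iff linear_add[OF N] linear_cmul[OF N] inner_left_distrib inner_right_distrib)
  define q where "q v w = second_form F x v w \<bullet> V x" for v w
  have qlin: "q (v + v') w = q v w + q v' w" "q v (w + w') = q v w + q v w'"
    "q (c *\<^sub>R v) w = c * q v w" "q v (c *\<^sub>R w) = c * q v w" for v v' w w' c
    unfolding q_def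
    by (simp_all add: linear_add[OF S(1)] linear_add[OF S(2)] linear_cmul[OF S(1)] linear_cmul[OF S(2)]
        inner_left_distrib)
  have "(\<Sum>b\<in>Basis. q v (e b) * q v (e b)) = (\<Sum>b\<in>Basis. q v (e' b) * q v (e' b))" for v
    using tr[of "\<lambda>w w'. q v w * q v w'"] by (simp add: linear_iff qlin algebra_simps)
  then have "(\<Sum>a\<in>Basis. \<Sum>b\<in>Basis. (q (e a) (e b))\<^sup>2)
      = (\<Sum>a\<in>Basis. \<Sum>b\<in>Basis. q (e a) (e' b) * q (e a) (e' b))"
    by (simp only: power2_eq_square)
  also have "\<dots> = (\<Sum>a\<in>Basis. \<Sum>b\<in>Basis. q (e' a) (e' b) * q (e' a) (e' b))"
    using tr[of "\<lambda>v v'. \<Sum>b\<in>Basis. q v (e' b) * q v' (e' b)"]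
    by (simp add: linear_iff qlin algebra_simps sum.distrib sum_distrib_left)
  finally have 2: "(\<Sum>a\<in>Basis. \<Sum>b\<in>Basis. (q (e a) (e b))\<^sup>2)
      = (\<Sum>a\<in>Basis. \<Sum>b\<in>Basis. (q (e' a) (e' b))\<^sup>2)"
    by (simp only: power2_eq_square)
  show ?thesis
    unfolding second_variation_integrand_def using 1 2 by (simp add: q_def)
qed

lemma ex_tangent_frame:
  fixes F :: "'a::euclidean_space \<Rightarrow> 'b::euclidean_space"
  assumes F: "F differentiable (at x)" and imm: "inj (frechet_derivative F (at x))"
  shows "\<exists>e. tangent_frame F x e"
proof -
  let ?A = "frechet_derivative F (at x)"
  have lin: "linear ?A" by (rule linear_frechet_derivative[OF F])
  have S: "subspace (range ?A)" by (rule linear_subspace_image[OF lin subspace_UNIV])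
  obtain B where B: "B \<subseteq> range ?A" "pairwise orthogonal B" "\<And>b. b \<in> B \<Longrightarrow> norm b = 1"
    "independent B" "card B = dim (range ?A)"
    using orthonormal_basis_subspace[OF S] by metis
  have "card B = DIM('a)" using dim_image_eq[OF lin, of UNIV] imm B(5) by simp
  moreover have "finite B" using B(4) by (rule finiteI_independent)
  ultimately obtain h where h: "bij_betw h (Basis :: 'a set) B"
    by (metis finite_same_card_bij finite_Basis)
  have "tangent_frame F x (\<lambda>a. inv ?A (h a))"
    unfolding tangent_frame_def
  proof (intro ballI)
    fix a b :: 'a assume ab: "a \<in> Basis" "b \<in> Basis"
    have hB: "h a \<in> B" "h b \<in> B" using h ab by (auto simp: bij_betw_def)
    have A: "?A (inv ?A (h a)) = h a" "?A (inv ?A (h b)) = h b"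
      using hB B(1) by (auto intro!: f_inv_into_f)
    show "?A (inv ?A (h a)) \<bullet> ?A (inv ?A (h b)) = (if a = b then 1 else 0)"
    proof (cases "a = b")
      case True
      then show ?thesis using B(3)[OF hB(1)] A by (simp add: norm_eq_1)
    next
      case False
      then have "h a \<noteq> h b" using h ab by (auto simp: bij_betw_def inj_on_def)
      then show ?thesis using B(2) hB A False by (auto simp: pairwise_def orthogonal_def)
    qed
  qed
  then show ?thesis by blast
qed


section \<open>Smoothness of the usual constructions\<close>

lemma Ck_const: "Ck n (\<lambda>x. c)"
  by (induction n arbitrary: c) (auto simp: frechet_derivative_const)

lemma Ck_bounded_linear: "bounded_linear f \<Longrightarrow> Ck n f"
proof (cases n)
  case (Suc m)
  assume f: "bounded_linear f"
  have "frechet_derivative f (at x) = f" for x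
    by (rule frechet_derivative_at[OF bounded_linear_imp_has_derivative[OF f], symmetric])
  then show ?thesis using Suc f by (auto simp: Ck_const bounded_linear_imp_differentiable)
qed (auto simp: linear_continuous_on)

lemma Ck_Suc_D: "Ck (Suc n) f \<Longrightarrow> Ck n f"
proof (induction n arbitrary: f)
  case 0
  then show ?case
    by (auto intro!: differentiable_imp_continuous_on simp: differentiable_on_def)
qed auto

lemma Ck_SucI:
  assumes "\<And>x. (f has_derivative f' x) (at x)" "\<And>v. Ck n (\<lambda>x. f' x v)"
  shows "Ck (Suc n) f"
proof -
  have "frechet_derivative f (at x) = f' x" for x
    by (rule frechet_derivative_at[OF assms(1), symmetric])
  then show ?thesis using assms by (auto simp: differentiable_def)
qed

lemma Ck_Suc_has_derivative:
  "Ck (Suc n) f \<Longrightarrow> (f has_derivative frechet_derivative f (at x)) (at x)"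
  by (simp add: frechet_derivative_works)

lemma Ck_add: "Ck n f \<Longrightarrow> Ck n g \<Longrightarrow> Ck n (\<lambda>x. f x + g x)"
proof (induction n arbitrary: f g)
  case (Suc n)
  show ?case
    using Suc by (intro Ck_SucI[OF has_derivative_add[OF Ck_Suc_has_derivative Ck_Suc_has_derivative]]) auto
qed (auto intro: continuous_intros)

lemma Ck_sum: "(\<And>i. i \<in> I \<Longrightarrow> Ck n (f i)) \<Longrightarrow> Ck n (\<lambda>x. \<Sum>i\<in>I. f i x)"
  by (induction I rule: infinite_finite_induct) (auto intro: Ck_const Ck_add)

lemma (in bounded_bilinear) Ck_prod: "Ck n f \<Longrightarrow> Ck n g \<Longrightarrow> Ck n (\<lambda>x. prod (f x) (g x))"
proof (induction n arbitrary: f g)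
  case 0
  then show ?case by (auto intro: continuous_on)
next
  case (Suc n)
  show ?case
  proof (rule Ck_SucI)
    show "((\<lambda>x. prod (f x) (g x)) has_derivative
        (\<lambda>h. prod (f x) (frechet_derivative g (at x) h) + prod (frechet_derivative f (at x) h) (g x))) (at x)" for x
      using Suc.prems by (intro FDERIV Ck_Suc_has_derivative)
    show "Ck n (\<lambda>x. prod (f x) (frechet_derivative g (at x) v) + prod (frechet_derivative f (at x) v) (g x))" for v
      using Suc.prems Ck_Suc_D[OF Suc.prems(1)] Ck_Suc_D[OF Suc.prems(2)]
      by (intro Ck_add Suc.IH) auto
  qed
qed

lemma has_derivative_complex_exp:
  fixes f :: "'a::real_normed_vector \<Rightarrow> complex"
  assumes "(f has_derivative f') (at x)"
  shows "((\<lambda>x. exp (f x)) has_derivative (\<lambda>h. f' h * exp (f x))) (at x)"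
  using has_derivative_compose[OF assms DERIV_exp[unfolded has_field_derivative_def]]
  by (simp add: mult.commute)

lemma Ck_exp_linear:
  fixes f :: "'a::real_normed_vector \<Rightarrow> complex"
  assumes "bounded_linear f"
  shows "Ck n (\<lambda>x. exp (f x))"
proof (induction n)
  case 0
  show ?case using continuous_on_exp[OF linear_continuous_on[OF assms]] by simp
next
  case (Suc n)
  show ?case
  proof (rule Ck_SucI)
    show "((\<lambda>x. exp (f x)) has_derivative (\<lambda>h. f h * exp (f x))) (at x)" for x
      using has_derivative_complex_exp[OF bounded_linear_imp_has_derivative[OF assms]] by simp
    show "Ck n (\<lambda>x. f v * exp (f x))" for v
      by (intro bounded_bilinear.Ck_prod[OF bounded_bilinear_mult] Ck_const Suc)
  qed
qed


section \<open>Generalized helicoids are minimal\<close>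

lemma helicoid_alt:
  "helicoid lam x =
     (\<Sum>j\<in>UNIV. (axis j (of_real (fst x $ j) * exp (\<i> * of_real (lam $ j * snd x))), 0)) + (0, snd x)"
  by (simp add: helicoid_def case_prod_beta prod_eq_iff fst_sum snd_sum vec_eq_iff sum_component axis_def)

lemma smooth_helicoid: "smooth (helicoid lam)"
proof -
  have lin1: "bounded_linear (\<lambda>z. (axis j z, 0) :: (complex ^ 'n) \<times> real)" for j
    by (intro linear_conv_bounded_linear[THEN iffD1] linearI) (auto simp: axis_def vec_eq_iff)
  have lin2: "bounded_linear (\<lambda>x :: (real ^ 'n) \<times> real. complex_of_real (fst x $ j))" for j
    by (intro linear_conv_bounded_linear[THEN iffD1] linearI) (auto simp: complex_eq_iff)
  have lin3: "bounded_linear (\<lambda>x :: (real ^ 'n) \<times> real. \<i> * complex_of_real (lam $ j * snd x))" for j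
    by (intro linear_conv_bounded_linear[THEN iffD1] linearI) (auto simp: scaleR_conv_of_real algebra_simps)
  have lin4: "bounded_linear (\<lambda>x :: (real ^ 'n) \<times> real. (0, snd x) :: (complex ^ 'n) \<times> real)"
    by (intro linear_conv_bounded_linear[THEN iffD1] linearI) auto
  have comp: "Ck n (\<lambda>x. L (g x))" if "bounded_linear L" "Ck n g"
    for L :: "complex \<Rightarrow> (complex ^ 'n) \<times> real" and g :: "(real ^ 'n) \<times> real \<Rightarrow> complex" and n
    using that(2)
  proof (induction n arbitrary: g)
    case 0
    then show ?case using that(1) by (auto intro: bounded_linear.continuous_on)
  next
    case (Suc n)
    show ?case
      using Suc.prems
      by (intro Ck_SucI[OF bounded_linear.has_derivative[OF that(1) Ck_Suc_has_derivative]] Suc.IH) auto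
  qed
  have "Ck n (\<lambda>x. helicoid lam x)" for n
    unfolding helicoid_alt
    by (intro Ck_add Ck_sum comp[OF lin1] bounded_bilinear.Ck_prod[OF bounded_bilinear_mult]
        Ck_bounded_linear lin2 Ck_exp_linear lin3 lin4)
  then show ?thesis by (simp add: smooth_def)
qed

lemma has_derivative_vec_lambda:
  fixes f :: "'k::finite \<Rightarrow> 'a::real_normed_vector \<Rightarrow> complex"
  assumes "\<And>j. (f j has_derivative f' j) (at x)"
  shows "((\<lambda>x. \<chi> j. f j x) has_derivative (\<lambda>h. \<chi> j. f' j h)) (at x)"
proof -
  have eq: "(\<chi> j. z j) = (\<Sum>j\<in>UNIV. axis j (z j))" for z :: "'k \<Rightarrow> complex"
    by (simp add: vec_eq_iff sum_component axis_def)
  have lin: "bounded_linear (axis j :: complex \<Rightarrow> complex ^ 'k)" for j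
    by (intro linear_conv_bounded_linear[THEN iffD1] linearI) (auto simp: axis_def vec_eq_iff)
  show ?thesis
    unfolding eq by (intro has_derivative_sum bounded_linear.has_derivative[OF lin] assms)
qed

definition helicoid_deriv ::
  "real ^ 'k \<Rightarrow> (real ^ 'k) \<times> real \<Rightarrow> (real ^ 'k) \<times> real \<Rightarrow> (complex ^ 'k) \<times> real" where
  "helicoid_deriv lam x h =
     (\<chi> j. (of_real (fst h $ j) + \<i> * of_real (lam $ j * snd h * fst x $ j))
            * exp (\<i> * of_real (lam $ j * snd x)), snd h)"

definition helicoid_deriv2 ::
  "real ^ 'k \<Rightarrow> (real ^ 'k) \<times> real \<Rightarrow> (real ^ 'k) \<times> real \<Rightarrow> (real ^ 'k) \<times> real \<Rightarrow> (complex ^ 'k) \<times> real" where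
  "helicoid_deriv2 lam x h w =
     (\<chi> j. (\<i> * of_real (lam $ j * (snd h * fst w $ j + snd w * fst h $ j))
              - of_real ((lam $ j)\<^sup>2 * snd h * snd w * fst x $ j))
            * exp (\<i> * of_real (lam $ j * snd x)), 0)"

lemma has_derivative_exp_snd:
  fixes x :: "'a::real_normed_vector \<times> real"
  shows "((\<lambda>x. exp (\<i> * complex_of_real (c * snd x))) has_derivative
     (\<lambda>h. \<i> * of_real (c * snd h) * exp (\<i> * of_real (c * snd x)))) (at x)"
proof -
  have "bounded_linear (\<lambda>x :: 'a \<times> real. \<i> * complex_of_real (c * snd x))"
    by (intro bounded_linear_mult_right[THEN bounded_linear_compose]
        bounded_linear_of_real[THEN bounded_linear_compose] bounded_linear_snd)
  from has_derivative_complex_exp[OF bounded_linear_imp_has_derivative[OF this]] show ?thesis by simp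
qed

lemma has_derivative_of_real_fst_nth:
  fixes x :: "(real ^ 'k) \<times> real"
  shows "((\<lambda>x. complex_of_real (fst x $ j)) has_derivative (\<lambda>h. of_real (fst h $ j))) (at x)"
proof -
  have "bounded_linear (\<lambda>x :: (real ^ 'k) \<times> real. complex_of_real (fst x $ j))"
    by (intro bounded_linear_of_real[THEN bounded_linear_compose]
        bounded_linear_vec_nth[THEN bounded_linear_compose] bounded_linear_fst)
  then show ?thesis by (rule bounded_linear_imp_has_derivative)
qed

lemma helicoid_has_derivative: "(helicoid lam has_derivative helicoid_deriv lam x) (at x)"
proof -
  have "((\<lambda>x. of_real (fst x $ j) * exp (\<i> * of_real (lam $ j * snd x))) has_derivative
      (\<lambda>h. (of_real (fst h $ j) + \<i> * of_real (lam $ j * snd h * fst x $ j))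
            * exp (\<i> * of_real (lam $ j * snd x)))) (at x)" for j
    by (rule has_derivative_eq_rhs[OF has_derivative_mult[OF has_derivative_of_real_fst_nth has_derivative_exp_snd]])
       (simp add: fun_eq_iff algebra_simps)
  then show ?thesis
    unfolding helicoid_def helicoid_deriv_def case_prod_beta
    by (intro has_derivative_Pair has_derivative_vec_lambda has_derivative_snd has_derivative_ident)
qed

lemma helicoid_deriv_has_derivative:
  "((\<lambda>y. helicoid_deriv lam y w) has_derivative (\<lambda>h. helicoid_deriv2 lam x h w)) (at x)"
proof -
  have 1: "((\<lambda>y. of_real (fst w $ j) + (\<i> * of_real (lam $ j * snd w)) * of_real (fst y $ j)) has_derivative
      (\<lambda>h. (\<i> * of_real (lam $ j * snd w)) * of_real (fst h $ j))) (at x)" for j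
    by (rule has_derivative_eq_rhs[OF has_derivative_add[OF has_derivative_const
          has_derivative_mult_right[OF has_derivative_of_real_fst_nth]]]) simp
  have "((\<lambda>y. (of_real (fst w $ j) + \<i> * of_real (lam $ j * snd w * fst y $ j))
              * exp (\<i> * of_real (lam $ j * snd y))) has_derivative
      (\<lambda>h. (\<i> * of_real (lam $ j * (snd h * fst w $ j + snd w * fst h $ j))
              - of_real ((lam $ j)\<^sup>2 * snd h * snd w * fst x $ j))
            * exp (\<i> * of_real (lam $ j * snd x)))) (at x)" for j
    using has_derivative_mult[OF 1[of j] has_derivative_exp_snd[of "lam $ j" x]]
    by (simp add: algebra_simps power2_eq_square)
  then show ?thesis
    unfolding helicoid_deriv_def helicoid_deriv2_def
    by (intro has_derivative_Pair has_derivative_vec_lambda has_derivative_const)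
qed

lemma frechet_derivative_helicoid: "frechet_derivative (helicoid lam) (at x) = helicoid_deriv lam x"
  by (rule frechet_derivative_at[OF helicoid_has_derivative, symmetric])

lemma frechet_derivative2_helicoid:
  "frechet_derivative (\<lambda>y. frechet_derivative (helicoid lam) (at y) w) (at x) h = helicoid_deriv2 lam x h w"
  unfolding frechet_derivative_helicoid
  by (rule fun_cong[OF frechet_derivative_at[OF helicoid_deriv_has_derivative], symmetric])

lemma inj_helicoid: "inj (helicoid lam)"
  by (rule injI) (auto simp: helicoid_def vec_eq_iff)

lemma immersion_helicoid: "inj (frechet_derivative (helicoid lam) (at x))"
  unfolding frechet_derivative_helicoid helicoid_deriv_def
  by (rule injI) (auto simp: vec_eq_iff prod_eq_iff)

lemma inner_helicoid_deriv:
  "helicoid_deriv lam x h \<bullet> helicoid_deriv lam x w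
     = fst h \<bullet> fst w + (1 + (\<Sum>j\<in>UNIV. (lam $ j * fst x $ j)\<^sup>2)) * snd h * snd w"
proof -
  have *: "((a + \<i> * b) * exp (\<i> * of_real t)) \<bullet> ((c + \<i> * d) * exp (\<i> * of_real t)) = a * c + b * d"
    for a b c d t :: real
  proof -
    have "((a + \<i> * b) * exp (\<i> * of_real t)) \<bullet> ((c + \<i> * d) * exp (\<i> * of_real t))
        = (a * cos t - b * sin t) * (c * cos t - d * sin t) + (a * sin t + b * cos t) * (c * sin t + d * cos t)"
      by (simp add: inner_complex_def cis_conv_exp[symmetric])
    also have "\<dots> = (a * c + b * d) * ((cos t)\<^sup>2 + (sin t)\<^sup>2)"
      by algebra
    finally show ?thesis by simp
  qed
  show ?thesis
    unfolding helicoid_deriv_def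
    by (simp only: inner_prod_def inner_vec_def vec_lambda_beta fst_conv snd_conv *)
       (simp add: sum.distrib sum_distrib_left sum_distrib_right algebra_simps power2_eq_square)
qed

theorem helicoid_minimal:
  fixes lam :: "real ^ 'n"
  shows "is_minimal (helicoid lam)"
  unfolding is_minimal_def
proof (intro allI impI)
  fix x :: "(real ^ 'n) \<times> real" and e
  assume e: "tangent_frame (helicoid lam) x e"
  let ?F = "helicoid lam"
  define r where "r = 1 + (\<Sum>j\<in>UNIV. (lam $ j * fst x $ j)\<^sup>2)"
  have r: "r > 0" unfolding r_def by (intro add_pos_nonneg sum_nonneg) auto
  define e' where "e' a = (fst a, snd a / sqrt r)" for a :: "(real ^ 'n) \<times> real"
  have e': "tangent_frame ?F x e'"
    unfolding tangent_frame_def frechet_derivative_helicoid inner_helicoid_deriv r_def[symmetric]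
  proof (intro ballI)
    fix a b :: "(real ^ 'n) \<times> real" assume ab: "a \<in> Basis" "b \<in> Basis"
    have "fst (e' a) \<bullet> fst (e' b) + r * snd (e' a) * snd (e' b) = a \<bullet> b"
      using r by (simp add: e'_def inner_prod_def)
    then show "fst (e' a) \<bullet> fst (e' b) + r * snd (e' a) * snd (e' b) = (if a = b then 1 else 0)"
      using ab by (simp add: inner_Basis)
  qed
  have "second_form ?F x (e' a) (e' a) = 0" if a: "a \<in> Basis" for a
  proof -
    have fs: "fst a = 0 \<or> snd a = 0" using a by (auto simp: Basis_prod_def)
    let ?w = "(\<chi> j. - ((lam $ j)\<^sup>2 * (snd (e' a))\<^sup>2 * fst x $ j), 0)"
    have "helicoid_deriv2 lam x (e' a) (e' a) = helicoid_deriv lam x ?w"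
      using fs by (auto simp: helicoid_deriv2_def helicoid_deriv_def e'_def vec_eq_iff power2_eq_square)
    then have "helicoid_deriv2 lam x (e' a) (e' a) \<in> tangent_space ?F x"
      by (simp add: tangent_space_def frechet_derivative_helicoid)
    then have "helicoid_deriv2 lam x (e' a) (e' a) - 0 \<in> (normal_subspace ?F x)\<^sup>\<bottom>"
      using orthogonal_comp_subset by (auto simp: normal_subspace_def)
    then show ?thesis
      unfolding second_form_def frechet_derivative2_helicoid
      by (intro orth_proj_unique subspace_normal_subspace subspace_0)
  qed
  then have "(\<Sum>a\<in>Basis. second_form ?F x (e' a) (e' a)) = 0" by simp
  moreover have "(\<Sum>a\<in>Basis. second_form ?F x (e a) (e a)) = (\<Sum>a\<in>Basis. second_form ?F x (e' a) (e' a))"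
    by (rule trace_frame_indep[where A = "frechet_derivative ?F (at x)" and B = "second_form ?F x"])
       (fact linear_frechet_derivative_smooth[OF smooth_helicoid] immersion_helicoid
          e[unfolded tangent_frame_def] e'[unfolded tangent_frame_def]
          linear_second_form[OF smooth_helicoid])+
  ultimately show "(\<Sum>a\<in>Basis. second_form ?F x (e a) (e a)) = 0" by simp
qed

end

theory Submission
  imports Defs
begin

text \<open>
  Put \<open>x\<^sub>j = \<lambda>\<^sub>j u\<^sub>j\<close> and \<open>W\<^sup>2 = 1 + |x|\<^sup>2\<close>. Normal fields are \<open>V = (i v\<^sub>j e\<^bsup>i \<lambda>\<^sub>j s\<^esup>, - \<langle>x, v\<rangle>)\<close> with \<open>v\<close> real,
  the volume density is \<open>W\<close>, and the second fundamental form contributes \<open>2 \<Sum> \<lambda>\<^sub>j\<^sup>2 v\<^sub>j\<^sup>2 / W\<^sup>2\<close>. Drop the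
  derivative of \<open>V\<close> along the \<open>s\<close>-lines and write the other ones as derivatives in \<open>x\<^sub>l\<close>, which produces
  factors \<open>\<lambda>\<^sub>l\<^sup>2 \<ge> \<lambda>\<^sub>m\<^sub>i\<^sub>n\<^sup>2\<close>. What remains is an inequality in which the \<open>\<lambda>\<^sub>j\<close> no longer appear:
  \<open>\<integral> W \<Sum>\<^sub>l |\<nabla>\<^sub>l V|\<^sup>2 dx \<ge> ((k - 1)\<^sup>2 / 4 + 1) \<integral> |v|\<^sup>2 / W dx\<close>, where \<open>\<nabla>\<close> is the normal connection.

  Here \<open>(k - 1)\<^sup>2 / 4\<close> is the constant of the radial Hardy inequality with weight \<open>W\<close>, and the additional
  \<open>1\<close> is the bottom of the spectrum of the rough Laplacian on vector fields of the sphere \<open>S\<^bsup>k - 1\<^esup>\<close>, found by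
  the Bochner argument: the null Lagrangian \<open>\<partial>\<^sub>l \<xi>\<^sub>j \<partial>\<^sub>j \<xi>\<^sub>l - (div \<xi>)\<^sup>2\<close> of the tangential part \<open>\<xi>\<close> of \<open>v\<close> is
  added with a weight that tends to \<open>1 / (k - 2)\<close> at infinity. Once these two divergences are added, the
  integrand is nonnegative pointwise.
\<close>

section \<open>Directional derivatives of compactly supported functions\<close>

text \<open>Mean value theorem on the segment from x to x + h v. Difference quotients become values
  of the derivative, which later serves both for domination and for limits.\<close>

lemma ex_directional_derivative:
  fixes f :: "'a::real_normed_vector \<Rightarrow> real"
  assumes f: "\<And>y. f differentiable (at y)" and h: "h > 0"
  shows "\<exists>t. 0 < t \<and> t < h \<and> f (x + h *\<^sub>R v) - f x = h * frechet_derivative f (at (x + t *\<^sub>R v)) v"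
proof -
  have der: "((\<lambda>t. f (x + t *\<^sub>R v)) has_derivative (\<lambda>s. s * frechet_derivative f (at (x + t *\<^sub>R v)) v)) (at t)"
    for t :: real
  proof -
    have "((\<lambda>t. x + t *\<^sub>R v) has_derivative (\<lambda>s. s *\<^sub>R v)) (at t)"
      by (auto intro!: derivative_eq_intros)
    from has_derivative_compose[OF this f[unfolded frechet_derivative_works]]
    have "((\<lambda>t. f (x + t *\<^sub>R v)) has_derivative (\<lambda>s. frechet_derivative f (at (x + t *\<^sub>R v)) (s *\<^sub>R v))) (at t)" .
    then show ?thesis
      by (simp add: linear_cmul[OF linear_frechet_derivative[OF f]])
  qed
  have "continuous_on {0..h} (\<lambda>t. f (x + t *\<^sub>R v))"
    by (rule has_derivative_continuous_on[OF has_derivative_at_withinI[OF der]])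
  from mvt[OF h this der] obtain t where "0 < t" "t < h"
    "f (x + h *\<^sub>R v) - f (x + 0 *\<^sub>R v) = (h - 0) * frechet_derivative f (at (x + t *\<^sub>R v)) v" by metis
  then show ?thesis by auto
qed

lemma integrable_lborel_compact_support:
  fixes f :: "'a::euclidean_space \<Rightarrow> real"
  assumes "continuous_on UNIV f" "compact S" "\<And>x. x \<notin> S \<Longrightarrow> f x = 0"
  shows "integrable lborel f"
proof -
  have "integrable lborel (\<lambda>x. indicator S x *\<^sub>R f x)"
    using assms by (intro borel_integrable_compact) (auto intro: continuous_on_subset)
  also have "(\<lambda>x. indicator S x *\<^sub>R f x) = f"
    using assms(3) by (auto simp: indicator_def fun_eq_iff)
  finally show ?thesis .
qed

lemma frechet_derivative_zero_outside:
  fixes f :: "'a::real_normed_vector \<Rightarrow> 'b::real_normed_vector"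
  assumes "closed S" "\<And>x. x \<notin> S \<Longrightarrow> f x = 0" "x \<notin> S"
  shows "frechet_derivative f (at x) v = 0"
proof -
  have "((\<lambda>_. 0) has_derivative (\<lambda>_. 0)) (at x)" by (rule has_derivative_const)
  then have "(f has_derivative (\<lambda>_. 0)) (at x)"
    by (rule has_derivative_transform_within_open[of _ _ _ _ "- S"]) (use assms in auto)
  from frechet_derivative_at[OF this] show ?thesis by (simp add: fun_eq_iff)
qed

text \<open>Translation invariance of Lebesgue measure makes the integral of every difference
  quotient zero; dominated convergence carries this over to the derivative.\<close>

lemma integral_directional_derivative_eq_0:
  fixes f :: "'a::euclidean_space \<Rightarrow> real"
  assumes f: "Ck 1 f" and S: "compact S" "\<And>x. x \<notin> S \<Longrightarrow> f x = 0"
  shows "integrable lborel (\<lambda>x. frechet_derivative f (at x) v)"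
    and "(LINT x|lborel. frechet_derivative f (at x) v) = 0"
proof -
  let ?g = "\<lambda>x. frechet_derivative f (at x) v"
  have diff: "f differentiable (at x)" for x using f by simp
  have cg: "continuous_on UNIV ?g" using f by simp
  have cf: "continuous_on UNIV f"
    using diff by (auto intro!: differentiable_imp_continuous_on simp: differentiable_on_def)
  have g0: "?g x = 0" if "x \<notin> S" for x
    using frechet_derivative_zero_outside[OF compact_imp_closed[OF S(1)] S(2) that] .
  show "integrable lborel ?g" by (rule integrable_lborel_compact_support[OF cg S(1) g0])
  obtain B where B: "\<And>x. norm (?g x) \<le> B" "B \<ge> 0"
  proof -
    have "compact (?g ` S)" by (rule compact_continuous_image[OF continuous_on_subset[OF cg] S(1)]) auto
    from compact_imp_bounded[OF this] obtain B where "\<forall>y\<in>?g ` S. norm y \<le> B"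
      unfolding bounded_iff by blast
    then have B: "norm (?g x) \<le> B" if "x \<in> S" for x using that by blast
    show ?thesis
    proof (rule that[of "\<bar>B\<bar>"])
      show "norm (?g x) \<le> \<bar>B\<bar>" for x
        using B[of x] g0[of x] by (cases "x \<in> S") auto
    qed simp
  qed
  \<comment> \<open>\<open>K\<close> contains the supports of all difference quotients with step at
    most 1: such a quotient is \<open>?g (x + t *\<^sub>R v)\<close> for some t in (0, 1), and
    \<open>?g\<close> vanishes off \<open>S\<close>.\<close>
  define K where "K = (\<lambda>(y, t). y - t *\<^sub>R v) ` (S \<times> {0..1::real})"
  have K: "compact K"
    unfolding K_def case_prod_beta
    by (rule compact_continuous_image[OF _ compact_Times[OF S(1) compact_Icc]]) (intro continuous_intros)
  let ?h = "\<lambda>n. inverse (real (Suc n))"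
  define q where "q n x = (f (x + ?h n *\<^sub>R v) - f x) / ?h n" for n x
  have h: "?h n > 0" "?h n \<le> 1" for n by (auto simp: field_simps)
  have q: "\<exists>t. 0 < t \<and> t < ?h n \<and> q n x = ?g (x + t *\<^sub>R v)" for n x
    using ex_directional_derivative[OF diff h(1)[of n], of x v] h(1)[of n] unfolding q_def
    by (metis nonzero_mult_div_cancel_left less_irrefl)
  have int_f: "integrable lborel f" by (rule integrable_lborel_compact_support[OF cf S])
  have shift: "has_bochner_integral lborel (\<lambda>x. f (x + w)) (integral\<^sup>L lborel f)" for w
  proof -
    have "has_bochner_integral (distr lborel borel ((+) w)) f (integral\<^sup>L lborel f)"
      using int_f by (simp add: lborel_distr_plus has_bochner_integral_integrable)
    then show ?thesis
      by (simp add: has_bochner_integral_iff integrable_distr_eq integral_distr add.commute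
          borel_measurable_continuous_onI[OF cf])
  qed
  have q0: "integral\<^sup>L lborel (q n) = 0" for n
    using shift[of "?h n *\<^sub>R v"] int_f unfolding q_def has_bochner_integral_iff by simp
  have "(\<lambda>n. integral\<^sup>L lborel (q n)) \<longlonglongrightarrow> integral\<^sup>L lborel ?g"
  proof (rule integral_dominated_convergence)
    show "?g \<in> borel_measurable lborel" using cg by (simp add: borel_measurable_continuous_onI)
    show "q n \<in> borel_measurable lborel" for n
      unfolding q_def using shift[of "?h n *\<^sub>R v"] int_f
      by (auto simp: has_bochner_integral_iff intro!: borel_measurable_divide borel_measurable_diff)
    show "integrable lborel (\<lambda>x. indicator K x * B)"
      using K by (auto intro!: emeasure_compact_finite borel_compact integrable_mult_left)
    show "AE x in lborel. (\<lambda>n. q n x) \<longlonglongrightarrow> ?g x"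
    proof (rule AE_I2)
      fix x
      obtain t where t: "\<And>n. 0 < t n \<and> t n < ?h n \<and> q n x = ?g (x + t n *\<^sub>R v)"
        using q[of _ x] by metis
      have "t \<longlonglongrightarrow> 0"
        by (rule tendsto_sandwich[OF _ _ tendsto_const LIMSEQ_inverse_real_of_nat])
           (use t in \<open>auto intro!: always_eventually less_imp_le\<close>)
      then have "(\<lambda>n. x + t n *\<^sub>R v) \<longlonglongrightarrow> x + 0 *\<^sub>R v" by (intro tendsto_intros)
      then have "(\<lambda>n. ?g (x + t n *\<^sub>R v)) \<longlonglongrightarrow> ?g (x + 0 *\<^sub>R v)"
        using cg by (auto intro!: continuous_on_tendsto_compose[OF cg])
      then show "(\<lambda>n. q n x) \<longlonglongrightarrow> ?g x" using t by simp
    qed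
    show "AE x in lborel. norm (q n x) \<le> indicator K x * B" for n
    proof (rule AE_I2)
      fix x
      obtain t where t: "0 < t" "t < ?h n" "q n x = ?g (x + t *\<^sub>R v)" using q by blast
      show "norm (q n x) \<le> indicator K x * B"
      proof (cases "x \<in> K")
        case False
        then have "x + t *\<^sub>R v \<notin> S"
          using t h(2)[of n] by (force simp: K_def image_iff)
        then show ?thesis using t(3) g0 by (simp add: False)
      qed (use t B in simp)
    qed
  qed
  then have "(\<lambda>n. 0) \<longlonglongrightarrow> integral\<^sup>L lborel ?g" by (simp add: q0)
  then show "integral\<^sup>L lborel ?g = 0" using LIMSEQ_const_iff by metis
qed

section \<open>Symmetry of second derivatives\<close>

lemma frechet_derivative_shift:
  assumes "f differentiable (at (x + c))"
  shows "(\<lambda>y. f (y + c)) differentiable (at x)"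
    and "frechet_derivative (\<lambda>y. f (y + c)) (at x) = frechet_derivative f (at (x + c))"
proof -
  have "((\<lambda>y. f (y + c)) has_derivative frechet_derivative f (at (x + c))) (at x)"
  proof -
    have "((\<lambda>y. y + c) has_derivative (\<lambda>h. h)) (at x)" by (auto intro!: derivative_eq_intros)
    from has_derivative_compose[OF this assms[unfolded frechet_derivative_works]] show ?thesis .
  qed
  then show "(\<lambda>y. f (y + c)) differentiable (at x)"
    "frechet_derivative (\<lambda>y. f (y + c)) (at x) = frechet_derivative f (at (x + c))"
    by (auto simp: differentiable_def frechet_derivative_at[symmetric])
qed

text \<open>The mean value theorem is applied twice: in direction \<open>a\<close> to the increment
  of \<open>f\<close> along \<open>b\<close>, then in direction \<open>b\<close> to the derivative
  of \<open>f\<close> along \<open>a\<close>.\<close>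

lemma second_difference_mean_value:
  fixes f :: "'a::real_normed_vector \<Rightarrow> real"
  assumes f: "Ck 2 f" and h: "h > 0"
  shows "\<exists>s t. 0 < s \<and> s < h \<and> 0 < t \<and> t < h \<and>
    f (x + h *\<^sub>R a + h *\<^sub>R b) - f (x + h *\<^sub>R a) - f (x + h *\<^sub>R b) + f x
      = h * h * frechet_derivative (\<lambda>y. frechet_derivative f (at y) a) (at (x + s *\<^sub>R a + t *\<^sub>R b)) b"
proof -
  have f1: "f differentiable (at y)" and f2: "(\<lambda>y. frechet_derivative f (at y) a) differentiable (at y)" for y
    using f by (auto simp: numeral_2_eq_2)
  let ?d = "\<lambda>y. f (y + h *\<^sub>R b) - f y"
  have d: "?d differentiable (at y)" for y
    by (intro differentiable_diff frechet_derivative_shift f1)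
  have fd: "frechet_derivative ?d (at y) a = frechet_derivative f (at (y + h *\<^sub>R b)) a - frechet_derivative f (at y) a" for y
  proof -
    have "(?d has_derivative (\<lambda>v. frechet_derivative f (at (y + h *\<^sub>R b)) v - frechet_derivative f (at y) v)) (at y)"
      using has_derivative_diff[OF frechet_derivative_shift(1)[OF f1, unfolded frechet_derivative_works]
         f1[unfolded frechet_derivative_works]]
      by (simp add: frechet_derivative_shift(2)[OF f1])
    from frechet_derivative_at[OF this, symmetric] show ?thesis by simp
  qed
  obtain s where s: "0 < s" "s < h" "?d (x + h *\<^sub>R a) - ?d x = h * frechet_derivative ?d (at (x + s *\<^sub>R a)) a"
    using ex_directional_derivative[of ?d h x a, OF d h] by blast
  obtain t where t: "0 < t" "t < h" "frechet_derivative f (at (x + s *\<^sub>R a + h *\<^sub>R b)) a - frechet_derivative f (at (x + s *\<^sub>R a)) a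
    = h * frechet_derivative (\<lambda>y. frechet_derivative f (at y) a) (at (x + s *\<^sub>R a + t *\<^sub>R b)) b"
    using ex_directional_derivative[OF f2 h, of "x + s *\<^sub>R a" b] by blast
  show ?thesis
    by (intro exI[of _ s] exI[of _ t]) (use s t fd[of "x + s *\<^sub>R a"] in \<open>simp add: algebra_simps\<close>)
qed

text \<open>The second difference quotient is symmetric in \<open>a\<close> and \<open>b\<close>,
  and by continuity of the second derivatives it tends to either iterated derivative.\<close>

lemma frechet_derivative_commute:
  fixes f :: "'a::real_normed_vector \<Rightarrow> real"
  assumes f: "Ck 2 f"
  shows "frechet_derivative (\<lambda>y. frechet_derivative f (at y) a) (at x) b
       = frechet_derivative (\<lambda>y. frechet_derivative f (at y) b) (at x) a"
proof -
  let ?D = "\<lambda>a b y. frechet_derivative (\<lambda>y. frechet_derivative f (at y) a) (at y) b"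
  let ?h = "\<lambda>n. inverse (real (Suc n))"
  let ?q = "\<lambda>n a b. (f (x + ?h n *\<^sub>R a + ?h n *\<^sub>R b) - f (x + ?h n *\<^sub>R a) - f (x + ?h n *\<^sub>R b) + f x) / (?h n * ?h n)"
  have lim: "(\<lambda>n. ?q n a b) \<longlonglongrightarrow> ?D a b x" for a b
  proof -
    have c: "continuous_on UNIV (?D a b)" using f by (auto simp: numeral_2_eq_2)
    have "\<exists>s t. 0 < s \<and> s < ?h n \<and> 0 < t \<and> t < ?h n \<and> ?q n a b = ?D a b (x + s *\<^sub>R a + t *\<^sub>R b)" for n
    proof -
      have "?h n > 0" by simp
      from second_difference_mean_value[OF f this, of x a b] show ?thesis
        by (metis \<open>?h n > 0\<close> less_irrefl mult_eq_0_iff nonzero_mult_div_cancel_left)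
    qed
    then obtain s t where st: "\<And>n. 0 < s n \<and> s n < ?h n \<and> 0 < t n \<and> t n < ?h n \<and> ?q n a b = ?D a b (x + s n *\<^sub>R a + t n *\<^sub>R b)"
      by metis
    have "s \<longlonglongrightarrow> 0"
      by (rule tendsto_sandwich[OF _ _ tendsto_const LIMSEQ_inverse_real_of_nat])
         (use st in \<open>auto intro!: always_eventually less_imp_le\<close>)
    moreover have "t \<longlonglongrightarrow> 0"
      by (rule tendsto_sandwich[OF _ _ tendsto_const LIMSEQ_inverse_real_of_nat])
         (use st in \<open>auto intro!: always_eventually less_imp_le\<close>)
    ultimately have "(\<lambda>n. x + s n *\<^sub>R a + t n *\<^sub>R b) \<longlonglongrightarrow> x + 0 *\<^sub>R a + 0 *\<^sub>R b" by (intro tendsto_intros)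
    then have "(\<lambda>n. ?D a b (x + s n *\<^sub>R a + t n *\<^sub>R b)) \<longlonglongrightarrow> ?D a b (x + 0 *\<^sub>R a + 0 *\<^sub>R b)"
      by (auto intro!: continuous_on_tendsto_compose[OF c])
    then show ?thesis using st by simp
  qed
  have "(\<lambda>n. ?q n a b) = (\<lambda>n. ?q n b a)" by (simp add: algebra_simps fun_eq_iff)
  then have "(\<lambda>n. ?q n a b) \<longlonglongrightarrow> ?D b a x" using lim[of b a] by (simp only:)
  then show ?thesis by (rule LIMSEQ_unique[OF lim])
qed


section \<open>The pointwise inequality\<close>

definition outer :: "real ^ 'n \<Rightarrow> real ^ 'm \<Rightarrow> real ^ 'm ^ 'n" where
  "outer a b = (\<chi> i j. a $ i * b $ j)"

lemma inner_outer: "outer a b \<bullet> A = a \<bullet> (A *v b)" "A \<bullet> outer a b = a \<bullet> (A *v b)"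
  by (simp_all add: outer_def inner_vec_def matrix_vector_mult_def sum_distrib_left mult_ac)

lemma outer_mult_vec: "outer a b *v c = (b \<bullet> c) *\<^sub>R a"
  by (simp add: outer_def inner_vec_def matrix_vector_mult_def vec_eq_iff sum_distrib_left sum_distrib_right mult_ac)

lemma transpose_outer: "transpose (outer a b) = outer b a"
  by (simp add: outer_def transpose_def mult.commute)

lemma trace_outer: "trace (outer a b) = a \<bullet> b"
  by (simp add: outer_def trace_def inner_vec_def)

lemma inner_mat_1: "mat 1 \<bullet> A = trace A" "A \<bullet> mat 1 = trace (A :: real ^ 'n ^ 'n)"
  by (simp_all add: mat_def inner_vec_def trace_def if_distrib if_distribR cong: if_cong)

lemma transpose_linear:
  "transpose (A + B) = transpose A + transpose B"
  "transpose (A - B) = transpose A - transpose B"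
  "transpose (c *\<^sub>R A) = c *\<^sub>R transpose A" for A :: "real ^ 'n ^ 'm"
  by (simp_all add: transpose_def vec_eq_iff)

lemma trace_scaleR: "trace (c *\<^sub>R A) = c * trace A" for A :: "real ^ 'n ^ 'n"
  by (simp add: trace_def sum_distrib_left)

lemma trace_transpose: "trace (transpose A) = trace A"
  by (simp add: trace_def transpose_def)

lemma trace_mat_1: "trace (mat 1 :: real ^ 'n ^ 'n) = real CARD('n)"
  by (simp add: trace_def mat_def)

lemma inner_transpose: "transpose A \<bullet> B = A \<bullet> transpose B" for A :: "real ^ 'n ^ 'm"
  by (simp add: transpose_def inner_vec_def) (rule sum.swap)

lemma inner_vector_matrix_mult: "a \<bullet> (b v* A) = b \<bullet> (A *v a)" for A :: "real ^ 'n ^ 'm"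
  by (metis dot_lmul_matrix inner_commute)

text \<open>The inner product of matrices is the Frobenius product. These rules reduce expressions
  in a matrix, rank-one matrices and the identity to inner products of vectors.\<close>

lemmas frobenius = inner_outer outer_mult_vec transpose_outer trace_outer inner_mat_1 transpose_linear
  trace_scaleR trace_transpose trace_mat_1 trace_add trace_sub matrix_vector_mult_add_rdistrib matrix_vector_mult_diff_rdistrib
  scaleR_matrix_vector_assoc[symmetric] matrix_vector_mult_scaleR vec.add vec.diff transpose_mat
  inner_add inner_diff inner_vector_matrix_mult

lemma trace_square_le:
  fixes T :: "real ^ 'n ^ 'n" and e :: "real ^ 'n"
  assumes e: "e \<bullet> e = 1" "e \<bullet> (T *v e) = 0" and c: "0 \<le> c" "c \<le> 1"
  shows "(1 + c) * (trace T)\<^sup>2 \<le> (real CARD('n) - 1) * (T \<bullet> T + c * (T \<bullet> transpose T))"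
proof -
  let ?P = "mat 1 - outer e e" and ?S = "T + transpose T" and ?A = "T - transpose T"
  have tt: "transpose T \<bullet> transpose T = T \<bullet> T" "transpose T \<bullet> T = T \<bullet> transpose T"
    by (simp_all add: inner_transpose inner_commute)
  have "?P \<bullet> ?P = real CARD('n) - 1" "?S \<bullet> ?P = 2 * trace T"
    using e by (simp_all add: frobenius inner_vector_matrix_mult)
  then have S: "4 * (trace T)\<^sup>2 \<le> (?S \<bullet> ?S) * (real CARD('n) - 1)"
    using Cauchy_Schwarz_ineq[of ?S ?P] by (simp add: power2_eq_square)
  have "4 * (T \<bullet> T + c * (T \<bullet> transpose T)) = (1 + c) * (?S \<bullet> ?S) + (1 - c) * (?A \<bullet> ?A)"
    by (simp add: inner_add inner_diff tt algebra_simps)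
  moreover have "(1 - c) * (?A \<bullet> ?A) \<ge> 0" using c by simp
  ultimately have *: "(1 + c) * (?S \<bullet> ?S) \<le> 4 * (T \<bullet> T + c * (T \<bullet> transpose T))" by linarith
  have n: "real CARD('n) - 1 \<ge> 0" by simp
  have "4 * ((1 + c) * (trace T)\<^sup>2) \<le> (1 + c) * ((?S \<bullet> ?S) * (real CARD('n) - 1))"
    using mult_left_mono[OF S, of "1 + c"] c by (simp add: mult_ac)
  also have "\<dots> \<le> 4 * ((real CARD('n) - 1) * (T \<bullet> T + c * (T \<bullet> transpose T)))"
    using mult_left_mono[OF * n] by (simp only: mult_ac)
  finally show ?thesis by (simp only: mult_le_cancel_left_pos zero_less_numeral)
qed

lemma quadratic_form_nonneg:
  fixes a b c x y :: real
  assumes "a > 0" "b\<^sup>2 \<le> a * c"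
  shows "0 \<le> a * x\<^sup>2 + 2 * b * x * y + c * y\<^sup>2"
proof -
  have "a * (a * x\<^sup>2 + 2 * b * x * y + c * y\<^sup>2) = (a * x + b * y)\<^sup>2 + (a * c - b\<^sup>2) * y\<^sup>2"
    by algebra
  also have "\<dots> \<ge> 0" using assms by simp
  finally show ?thesis using assms(1) by (simp add: zero_le_mult_iff)
qed

text \<open>This is what is left of the integrand after all squares have been completed: a quadratic
  form in \<open>tau\<close> and \<open>a\<close>, plus a multiple of \<open>n\<close>. With
  \<open>A\<close> the coefficient of \<open>a\<^sup>2\<close>, the discriminant condition is a
  polynomial inequality in r^2 whose coefficients are nonnegative for m >= 1.\<close>

lemma residual_nonneg:
  fixes r a m n tau :: real
  assumes m: "m \<ge> 1" and n: "n \<ge> 0"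
  defines "w \<equiv> 1 + r\<^sup>2"
  shows "0 \<le> (w\<^sup>2 - r^4) * tau\<^sup>2 / (2 * m) + 2 * r^3 * a * tau - 2 * m * r\<^sup>2 * a\<^sup>2 + r\<^sup>2 * n
    + (n + w * a\<^sup>2) * (m * ((2 * m + 1) * w - r\<^sup>2) - m\<^sup>2 * r\<^sup>2) - (m\<^sup>2 + 1) * w * (n + a\<^sup>2)"
proof -
  define p where "p = r\<^sup>2"
  define A where "A = (1 + p) * (m * ((2 * m + 1) * (1 + p) - p) - m\<^sup>2 * p - (m\<^sup>2 + 1)) - 2 * m * p"
  have p: "p \<ge> 0" by (simp add: p_def)
  have "(r^3)\<^sup>2 \<le> ((1 + 2 * p) / (2 * m)) * A"
  proof -
    have "(1 + 2 * p) * A - 2 * m * p^3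
        = (m\<^sup>2 + m - 1) + ((2 * m + 1) * (m - 1) + 2 * (m\<^sup>2 + m - 1)) * p
          + (2 * (2 * m + 1) * (m - 1) + m\<^sup>2) * p\<^sup>2 + 2 * m * (m - 1) * p^3"
      unfolding A_def by algebra
    also have "\<dots> \<ge> 0"
    proof -
      have "m\<^sup>2 + m - 1 \<ge> 0" using m by (smt (verit) zero_le_power2)
      then show ?thesis using m p by (intro add_nonneg_nonneg mult_nonneg_nonneg) auto
    qed
    finally have "2 * m * p^3 \<le> (1 + 2 * p) * A" by simp
    moreover have "(r^3)\<^sup>2 = p^3" unfolding p_def by algebra
    ultimately show ?thesis using m by (simp add: field_simps)
  qed
  from quadratic_form_nonneg[OF _ this, of tau a]
  have "0 \<le> (1 + 2 * p) / (2 * m) * tau\<^sup>2 + 2 * r^3 * tau * a + A * a\<^sup>2"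
    using m p by simp
  \<comment> \<open>In the coefficient of \<open>n\<close> all powers of \<open>r\<close> cancel;
    after subtraction of the Hardy constant m^2 + 1 there remains m^2 + m - 1.\<close>
  moreover have "0 \<le> (m\<^sup>2 + m - 1) * n"
    using m n by (intro mult_nonneg_nonneg) (smt (verit) zero_le_power2)+
  moreover have "(w\<^sup>2 - r^4) * tau\<^sup>2 / (2 * m) = (1 + 2 * p) / (2 * m) * tau\<^sup>2"
  proof -
    have "w\<^sup>2 - r^4 = 1 + 2 * p" unfolding w_def p_def by algebra
    then show ?thesis by simp
  qed
  moreover have "2 * r^3 * a * tau - 2 * m * r\<^sup>2 * a\<^sup>2 + r\<^sup>2 * n
    + (n + w * a\<^sup>2) * (m * ((2 * m + 1) * w - r\<^sup>2) - m\<^sup>2 * r\<^sup>2) - (m\<^sup>2 + 1) * w * (n + a\<^sup>2)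
    = 2 * r^3 * tau * a + A * a\<^sup>2 + (m\<^sup>2 + m - 1) * n"
    unfolding A_def w_def p_def by algebra
  ultimately show ?thesis by linarith
qed

text \<open>
  Everything is split along the radial direction \<open>e\<close>, where \<open>x = r *\<^sub>R e\<close>. Row \<open>l\<close> of \<open>p\<close> is the
  derivative of \<open>v\<close> in direction \<open>l\<close>, so \<open>pr\<close> is the radial derivative of \<open>v\<close>, \<open>pc\<close> the derivative of
  its radial component, and \<open>T\<close> the doubly tangential part of \<open>p\<close>.
\<close>

locale radial_splitting =
  fixes p :: "real ^ 'k ^ 'k" and e v :: "real ^ 'k" and r om :: real
  assumes e: "e \<bullet> e = 1" and om: "om > 0" "om\<^sup>2 * (1 + r\<^sup>2) = 1"
begin

definition "x = r *\<^sub>R e"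
definition "a = v \<bullet> e"
definition "s = e \<bullet> (p *v e)"
definition "pr = e v* p"
definition "pc = p *v e"
definition "T = p - outer e pr - outer pc e + s *\<^sub>R outer e e"
text \<open>Row l of \<open>y\<close> holds the coordinates of the normal derivative of V in
  direction l, so \<open>y \<bullet> y + (y *v x) \<bullet> (y *v x)\<close> is the sum of the
  squared lengths of these derivatives. Further, \<open>g\<close> is the gradient of
  \<open>t\<close>, \<open>M\<close> the Jacobian of \<open>xi\<close>, \<open>N\<close> the squared
  length of V, and \<open>R\<close> is |xi|^2 / r^2 written so as to be smooth at the
  origin.\<close>

definition "y = p + om\<^sup>2 *\<^sub>R outer v x"
definition "t = x \<bullet> v"
definition "g = v + p *v x"
definition "M = 2 *\<^sub>R outer x v + r\<^sup>2 *\<^sub>R p - outer g x - t *\<^sub>R mat 1"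
definition "xi = r\<^sup>2 *\<^sub>R v - t *\<^sub>R x"
definition "N = v \<bullet> v + t\<^sup>2"
definition "R = r\<^sup>2 * (v \<bullet> v) - t\<^sup>2"

lemma atoms: "p *v e = pc" "e v* p = pr" "e \<bullet> e = 1" "x = r *\<^sub>R e"
  "e \<bullet> pc = s" "pc \<bullet> e = s" "e \<bullet> pr = s" "pr \<bullet> e = s" "v \<bullet> e = a" "e \<bullet> v = a"
  "e \<bullet> (p *v z) = pr \<bullet> z" "t = r * a"
  using e by (simp_all add: x_def a_def s_def pr_def pc_def t_def inner_vector_matrix_mult dot_lmul_matrix inner_commute)

lemma T_inner: "T \<bullet> T = p \<bullet> p - pr \<bullet> pr - pc \<bullet> pc + s\<^sup>2"
  "T \<bullet> transpose T = p \<bullet> transpose p - 2 * (pr \<bullet> pc) + s\<^sup>2" "trace T = trace p - s" "e \<bullet> (T *v e) = 0"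
  by (simp_all add: T_def frobenius atoms algebra_simps inner_commute power2_eq_square)


text \<open>The four summands are the tangential derivatives of the tangential part, the radial
  derivative of the tangential part, and the radial and tangential derivatives of the radial part;
  the last two are coupled to \<open>v\<close> by the normal connection.\<close>

lemma energy_eq: "y \<bullet> y + (y *v x) \<bullet> (y *v x)
  = T \<bullet> T + (pr - s *\<^sub>R e) \<bullet> (pr - s *\<^sub>R e) + om\<^sup>2 * ((1 + r\<^sup>2) * s + r * a)\<^sup>2
    + om\<^sup>2 * (((1 + r\<^sup>2) *\<^sub>R (pc - s *\<^sub>R e) + r *\<^sub>R (v - a *\<^sub>R e)) \<bullet> ((1 + r\<^sup>2) *\<^sub>R (pc - s *\<^sub>R e) + r *\<^sub>R (v - a *\<^sub>R e)))"
proof -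
  let ?w = "1 + r\<^sup>2"
  have "y \<bullet> y + (y *v x) \<bullet> (y *v x)
      = p \<bullet> p + r\<^sup>2 * (pc \<bullet> pc) + 2 * r * (om\<^sup>2 * ?w) * (v \<bullet> pc) + om\<^sup>2 * (om\<^sup>2 * ?w) * r\<^sup>2 * (v \<bullet> v)"
    by (simp add: y_def frobenius atoms inner_commute) (simp add: algebra_simps power2_eq_square power4_eq_xxxx)
  also have "\<dots> = p \<bullet> p + r\<^sup>2 * (pc \<bullet> pc) + 2 * r * (v \<bullet> pc) + om\<^sup>2 * r\<^sup>2 * (v \<bullet> v)"
    by (simp only: om mult_1_right)
  \<comment> \<open>Factors \<open>om\<^sup>2 * ?w\<close>, equal to 1, are inserted exactly where
    they turn the last two groups into \<open>om\<^sup>2\<close> times a perfect square.\<close>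
  also have "\<dots> = p \<bullet> p - pr \<bullet> pr - pc \<bullet> pc + s\<^sup>2 + (pr \<bullet> pr - s\<^sup>2)
    + (om\<^sup>2 * ?w) * (?w * s\<^sup>2 + 2 * r * a * s) + om\<^sup>2 * r\<^sup>2 * a\<^sup>2
    + (om\<^sup>2 * ?w) * (?w * (pc \<bullet> pc - s\<^sup>2) + 2 * r * (v \<bullet> pc - a * s)) + om\<^sup>2 * r\<^sup>2 * (v \<bullet> v - a\<^sup>2)"
    by (simp only: om) (simp add: algebra_simps)
  also have "\<dots> = T \<bullet> T + (pr - s *\<^sub>R e) \<bullet> (pr - s *\<^sub>R e) + om\<^sup>2 * (?w * s + r * a)\<^sup>2
    + om\<^sup>2 * ((?w *\<^sub>R (pc - s *\<^sub>R e) + r *\<^sub>R (v - a *\<^sub>R e)) \<bullet> (?w *\<^sub>R (pc - s *\<^sub>R e) + r *\<^sub>R (v - a *\<^sub>R e)))"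
    unfolding T_inner by (simp add: inner_add inner_diff atoms inner_commute) (simp add: algebra_simps power2_eq_square)
  finally show ?thesis .
qed

text \<open>The first identity is the derivative of the second one. The last two express the
  divergence of \<open>xi\<close> and the quadratic part of its null Lagrangian through
  \<open>T\<close>.\<close>

lemma M_facts:
  "M *v x = - xi" "xi \<bullet> x = 0" "xi \<bullet> xi = r\<^sup>2 * R"
  "trace M = r\<^sup>2 * trace T - (real CARD('k) - 1) * t"
  "M \<bullet> transpose M = r^4 * (T \<bullet> transpose T) - 2 * r\<^sup>2 * t * trace T + (real CARD('k) - 1) * t\<^sup>2
     + 2 * r\<^sup>2 * t * s + 4 * t\<^sup>2 - 4 * r\<^sup>2 * (v \<bullet> v) - 2 * r^3 * (pr \<bullet> v)"
proof -
  show "M *v x = - xi"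
    by (simp add: M_def xi_def g_def frobenius atoms vec_eq_iff algebra_simps power2_eq_square)
qed (simp_all add: M_def xi_def R_def g_def T_inner frobenius atoms inner_commute,
    simp_all add: algebra_simps power2_eq_square power3_eq_cube power4_eq_xxxx inner_commute)

definition "dN = 2 *\<^sub>R (p *v v) + (2 * t) *\<^sub>R g"
definition "dR = (2 * (v \<bullet> v)) *\<^sub>R x + (2 * r\<^sup>2) *\<^sub>R (p *v v) - (2 * t) *\<^sub>R g"

lemma radial_derivs:
  "x \<bullet> dN = 2 * r * (pr \<bullet> v - a * s) + 2 * r * a * ((1 + r\<^sup>2) * s + r * a)"
  "x \<bullet> dR = 2 * r\<^sup>2 * (v \<bullet> v) + 2 * r^3 * (pr \<bullet> v) - 2 * t * (r * a + r\<^sup>2 * s)"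
  by (simp_all add: dN_def dR_def g_def frobenius atoms) (simp_all add: algebra_simps power2_eq_square power3_eq_cube)

text \<open>The divergence of the vector field \<open>Z\<close> defined below, with \<open>M\<close>, \<open>dN\<close>, \<open>dR\<close> in the roles of
  the derivatives of \<open>xi\<close>, \<open>N\<close>, \<open>R\<close>.\<close>

definition "divergence m =
  m * (real CARD('k) * N * om + om * (x \<bullet> dN) - r\<^sup>2 * om^3 * N)
  + (om^3 * (M \<bullet> transpose M - (trace M)\<^sup>2) - 3 * om^5 * (xi \<bullet> (M *v x) - (xi \<bullet> x) * trace M)
     + om^3 * (real CARD('k) * R + x \<bullet> dR) - 3 * om^5 * r\<^sup>2 * R) / (real CARD('k) - 2)"

text \<open>The \<open>om^5\<close> terms cancel because \<open>xi \<bullet> (M *v x)\<close> equals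
  -r^2 R. In the \<open>om^3\<close> bracket everything except the minors of \<open>T\<close>
  carries a factor k - 2, which the denominator removes.\<close>

lemma divergence_eq:
  assumes "CARD('k) \<ge> 3"
  shows "divergence m = om * (m * (real CARD('k) * N + x \<bullet> dN - om\<^sup>2 * r\<^sup>2 * N)
    + om\<^sup>2 * (r^4 * (T \<bullet> transpose T - (trace T)\<^sup>2) / (real CARD('k) - 2) + 2 * r\<^sup>2 * t * trace T
        - (real CARD('k) - 1) * t\<^sup>2 + R))"
proof -
  let ?K = "real CARD('k)"
  have K: "?K - 2 \<noteq> 0" using assms by auto
  have *: "M \<bullet> transpose M - (trace M)\<^sup>2 + (?K * R + x \<bullet> dR)
    = r^4 * (T \<bullet> transpose T - (trace T)\<^sup>2) + (?K - 2) * (2 * r\<^sup>2 * t * trace T - (?K - 1) * t\<^sup>2 + R)"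
    unfolding M_facts radial_derivs R_def
    by (simp add: atoms algebra_simps power2_eq_square power3_eq_cube power4_eq_xxxx)
  have "om^3 * (M \<bullet> transpose M - (trace M)\<^sup>2) - 3 * om^5 * (xi \<bullet> (M *v x) - (xi \<bullet> x) * trace M)
     + om^3 * (?K * R + x \<bullet> dR) - 3 * om^5 * r\<^sup>2 * R
     = om^3 * (M \<bullet> transpose M - (trace M)\<^sup>2 + (?K * R + x \<bullet> dR))"
    by (simp add: M_facts(1,2,3) algebra_simps)
  also have "\<dots> / (?K - 2) = om^3 * (r^4 * (T \<bullet> transpose T - (trace T)\<^sup>2) / (?K - 2)
      + (2 * r\<^sup>2 * t * trace T - (?K - 1) * t\<^sup>2 + R))"
    unfolding * using K by (simp add: field_simps)
  finally show ?thesis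
    unfolding divergence_def by (simp add: algebra_simps power2_eq_square power3_eq_cube)
qed

lemma integrand_nonneg:
  assumes K: "CARD('k) \<ge> 3" and m: "m = (real CARD('k) - 1) / 2"
  shows "0 \<le> (y \<bullet> y + (y *v x) \<bullet> (y *v x)) / om - (m\<^sup>2 + 1) * om * (v \<bullet> v) + divergence m"
proof -
  let ?K = "real CARD('k)" and ?w = "1 + r\<^sup>2" and ?i = "om\<^sup>2"
  \<comment> \<open>Weight of the null Lagrangian relative to the energy of \<open>T\<close>. It
    lies in [0, 1], as \<open>trace_square_le\<close> demands, since om^2 r^2 <= 1 and k - 2 >=
    1.\<close>
  define c where "c = r^4 * ?i\<^sup>2 / (?K - 2)"
  define n where "n = v \<bullet> v - a\<^sup>2"
  let ?tau = "trace T"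
  have Km: "?K = 2 * m + 1" using m by simp
  have m1: "m \<ge> 1" using K m by simp
  have iw: "?i * ?w = 1" by (rule om)
  have w: "?w > 0" by (smt (verit) zero_le_power2)
  have n: "n \<ge> 0"
    using Cauchy_Schwarz_ineq[of v e] e by (simp add: n_def a_def)
  have ir: "?i * r\<^sup>2 \<le> 1" "0 \<le> ?i * r\<^sup>2" using iw by (simp_all add: algebra_simps) (smt (verit) zero_le_power2)
  have c: "0 \<le> c" "c \<le> 1"
  proof -
    have "(?i * r\<^sup>2)\<^sup>2 \<le> 1" using ir by (simp add: power_le_one)
    moreover have "r^4 * ?i\<^sup>2 = (?i * r\<^sup>2)\<^sup>2" by (simp add: power2_eq_square power4_eq_xxxx)
    ultimately show "0 \<le> c" "c \<le> 1" using m1 Km unfolding c_def by (auto simp: divide_le_eq)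
  qed
  define Q where "Q = T \<bullet> T + c * (T \<bullet> transpose T)"
  have F1: "?w * Q \<ge> ?w * ((1 + c) * ?tau\<^sup>2 / (2 * m))"
    using trace_square_le[OF e T_inner(4) c] w m1 Km unfolding Q_def
    by (intro mult_left_mono) (simp_all add: divide_le_eq mult.commute)
  let ?q = "pr - s *\<^sub>R e" and ?z = "v - a *\<^sub>R e"
  have qz: "?q \<bullet> ?z = pr \<bullet> v - a * s" "?z \<bullet> ?z = n"
    unfolding n_def by (simp_all add: inner_diff atoms inner_commute power2_eq_square)
  \<comment> \<open>\<open>F2\<close> and \<open>F3\<close> complete squares to absorb the cross
    terms contributed by \<open>m * (x \<bullet> dN)\<close>; together they cost m^2 r^2 om^2
    N.\<close>
  have F2: "0 \<le> ?w * (?q \<bullet> ?q) + 2 * m * r * (pr \<bullet> v - a * s) + m\<^sup>2 * r\<^sup>2 * ?i * n"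
  proof -
    have "0 \<le> ?w * ((?q + (m * r * ?i) *\<^sub>R ?z) \<bullet> (?q + (m * r * ?i) *\<^sub>R ?z))" using w by simp
    also have "\<dots> = ?w * (?q \<bullet> ?q + 2 * (m * r * ?i) * (?q \<bullet> ?z) + (m * r * ?i)\<^sup>2 * (?z \<bullet> ?z))"
      by (simp only: inner_add_left inner_add_right inner_scaleR_left inner_scaleR_right inner_commute[of ?z ?q])
        (simp add: algebra_simps power2_eq_square)
    also have "\<dots> = ?w * (?q \<bullet> ?q) + (?i * ?w) * (2 * m * r * (?q \<bullet> ?z)) + (?i * ?w) * (m\<^sup>2 * r\<^sup>2 * ?i * (?z \<bullet> ?z))"
      by (simp only: power_mult_distrib power2_eq_square ring_distribs mult_ac)
    finally show ?thesis unfolding iw qz by simp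
  qed
  have F3: "0 \<le> (?w * s + r * a)\<^sup>2 + 2 * m * r * a * (?w * s + r * a) + m\<^sup>2 * r\<^sup>2 * a\<^sup>2"
  proof -
    have "0 \<le> (?w * s + r * a + m * r * a)\<^sup>2" by simp
    then show ?thesis by (simp add: power2_eq_square algebra_simps)
  qed
  define Z where "Z = (?w *\<^sub>R (pc - s *\<^sub>R e) + r *\<^sub>R ?z) \<bullet> (?w *\<^sub>R (pc - s *\<^sub>R e) + r *\<^sub>R ?z)"
  have Z: "Z \<ge> 0" by (simp add: Z_def)
  define E where "E = y \<bullet> y + (y *v x) \<bullet> (y *v x)"
  have E: "?w * E = ?w * (T \<bullet> T) + ?w * (?q \<bullet> ?q) + (?w * s + r * a)\<^sup>2 + Z"
  proof -
    have "?w * E = ?w * (T \<bullet> T) + ?w * (?q \<bullet> ?q) + (?i * ?w) * (?w * s + r * a)\<^sup>2 + (?i * ?w) * Z"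
      unfolding E_def energy_eq Z_def[symmetric] by (simp only: ring_distribs mult_ac)
    then show ?thesis unfolding iw by simp
  qed
  define L where "L = ?w * (T \<bullet> T) + ?i * (r^4 * (T \<bullet> transpose T - ?tau\<^sup>2) / (?K - 2))"
  \<comment> \<open>Since \<open>?w * c\<close> is om^2 r^4 / (k - 2), \<open>F1\<close> bounds
    \<open>T\<close> and its minors from below by the trace alone. Here k - 1 = 2m and k - 2 = 2m -
    1.\<close>
  have L: "?i * ((?w\<^sup>2 - r^4) * ?tau\<^sup>2 / (2 * m)) \<le> L"
  proof -
    define d where "d = ?i * r^4 / (?K - 2)"
    have d: "?i * r^4 = d * (2 * m - 1)" unfolding d_def Km using m1 by simp
    have "?w * c = (?i * ?w) * d" unfolding c_def d_def by (simp add: power2_eq_square)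
    then have wc: "?w * c = d" unfolding iw by simp
    have "?i * ((?w\<^sup>2 - r^4) * ?tau\<^sup>2 / (2 * m)) = ((?i * ?w) * ?w - ?i * r^4) * ?tau\<^sup>2 / (2 * m)"
      by (simp add: algebra_simps power2_eq_square)
    also have "\<dots> = (?w + d) * ?tau\<^sup>2 / (2 * m) - d * ?tau\<^sup>2"
      unfolding iw d using m1 by (simp add: field_simps)
    also have "(?w + d) * ?tau\<^sup>2 / (2 * m) = ?w * ((1 + c) * ?tau\<^sup>2 / (2 * m))"
      by (simp add: wc[symmetric] algebra_simps)
    also have "\<dots> - d * ?tau\<^sup>2 \<le> ?w * Q - d * ?tau\<^sup>2" using F1 by simp
    also have "?w * Q = ?w * (T \<bullet> T) + d * (T \<bullet> transpose T)"
      unfolding Q_def by (simp add: wc[symmetric] algebra_simps)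
    also have "\<dots> - d * ?tau\<^sup>2 = L" unfolding L_def d_def by (simp add: algebra_simps diff_divide_distrib)
    finally show ?thesis .
  qed
  define G where "G = m * (?K * N + x \<bullet> dN - ?i * r\<^sup>2 * N)
    + ?i * (r^4 * (T \<bullet> transpose T - ?tau\<^sup>2) / (?K - 2) + 2 * r\<^sup>2 * t * ?tau - (?K - 1) * t\<^sup>2 + R)"
  have NR: "N = n + ?w * a\<^sup>2" "R = r\<^sup>2 * n" "t = r * a" "v \<bullet> v = n + a\<^sup>2"
    unfolding N_def R_def n_def by (simp_all add: atoms algebra_simps power2_eq_square)
  have "?i * ((?w\<^sup>2 - r^4) * ?tau\<^sup>2 / (2 * m) + 2 * r^3 * a * ?tau - 2 * m * r\<^sup>2 * a\<^sup>2 + r\<^sup>2 * n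
    + (n + ?w * a\<^sup>2) * (m * ((2 * m + 1) * ?w - r\<^sup>2) - m\<^sup>2 * r\<^sup>2) - (m\<^sup>2 + 1) * ?w * (n + a\<^sup>2)) \<ge> 0"
    using residual_nonneg[OF m1 n] by simp
  also have "?i * ((?w\<^sup>2 - r^4) * ?tau\<^sup>2 / (2 * m) + 2 * r^3 * a * ?tau - 2 * m * r\<^sup>2 * a\<^sup>2 + r\<^sup>2 * n
    + (n + ?w * a\<^sup>2) * (m * ((2 * m + 1) * ?w - r\<^sup>2) - m\<^sup>2 * r\<^sup>2) - (m\<^sup>2 + 1) * ?w * (n + a\<^sup>2))
    = ?i * ((?w\<^sup>2 - r^4) * ?tau\<^sup>2 / (2 * m)) + ?i * (2 * r\<^sup>2 * t * ?tau - (?K - 1) * t\<^sup>2 + R)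
      + m * (?K * (?i * ?w) * N - ?i * r\<^sup>2 * N) - m\<^sup>2 * r\<^sup>2 * (?i * n + (?i * ?w) * a\<^sup>2) - (m\<^sup>2 + 1) * (?i * ?w) * (v \<bullet> v)"
    unfolding NR Km by (simp add: algebra_simps power2_eq_square power3_eq_cube)
  also have "\<dots> \<le> ?w * E - (m\<^sup>2 + 1) * (v \<bullet> v) + G"
    unfolding iw using L F2 F3 Z unfolding E G_def L_def radial_derivs
    by (simp add: algebra_simps)
  finally have "0 \<le> om * (?w * E - (m\<^sup>2 + 1) * (v \<bullet> v) + G)" using om(1) by simp
  also have "\<dots> = (om * ?w) * E - (m\<^sup>2 + 1) * om * (v \<bullet> v) + om * G"
    by (simp add: algebra_simps)
  also have "om * ?w = 1 / om" using iw om(1) by (simp add: field_simps power2_eq_square)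
  finally show ?thesis
    unfolding divergence_eq[OF K] E_def G_def by simp
qed

text \<open>Variables with defining equations replace the locale constants and
  \<open>X \<bullet> X\<close> replaces r^2, so that only \<open>X\<close> and no polar
  decomposition is left in the conclusion.\<close>

lemma hardy_integrand_nonneg_polar:
  assumes K: "CARD('k) \<ge> 3" and m: "m = (real CARD('k) - 1) / 2" and X: "X = r *\<^sub>R e"
    and Y: "Y = p + om\<^sup>2 *\<^sub>R outer v X" and tau: "tau = X \<bullet> v" and G: "G = v + p *v X"
    and H: "H = 2 *\<^sub>R outer X v + (X \<bullet> X) *\<^sub>R p - outer G X - tau *\<^sub>R mat 1"
    and Xi: "Xi = (X \<bullet> X) *\<^sub>R v - tau *\<^sub>R X"
    and n: "n = v \<bullet> v + tau\<^sup>2" and q: "q = (X \<bullet> X) * (v \<bullet> v) - tau\<^sup>2"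
    and dn: "dn = 2 *\<^sub>R (p *v v) + (2 * tau) *\<^sub>R G"
    and dq: "dq = (2 * (v \<bullet> v)) *\<^sub>R X + (2 * (X \<bullet> X)) *\<^sub>R (p *v v) - (2 * tau) *\<^sub>R G"
  shows "0 \<le> (Y \<bullet> Y + (Y *v X) \<bullet> (Y *v X)) / om - (m\<^sup>2 + 1) * om * (v \<bullet> v)
    + (m * (real CARD('k) * n * om + om * (X \<bullet> dn) - (X \<bullet> X) * om^3 * n)
       + (om^3 * (H \<bullet> transpose H - (trace H)\<^sup>2) - 3 * om^5 * (Xi \<bullet> (H *v X) - (Xi \<bullet> X) * trace H)
          + om^3 * (real CARD('k) * q + X \<bullet> dq) - 3 * om^5 * (X \<bullet> X) * q) / (real CARD('k) - 2))"
proof -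
  have XX: "r *\<^sub>R e \<bullet> r *\<^sub>R e = r\<^sup>2" by (simp add: e power2_eq_square)
  show ?thesis
    using integrand_nonneg[OF K m]
    unfolding Y dn dq n q H Xi G tau X XX divergence_def
      M_def xi_def dN_def dR_def N_def R_def g_def t_def y_def x_def .
qed

end

lemma hardy_integrand_nonneg:
  fixes p H Y :: "real ^ 'k ^ 'k" and X v G Xi dn dq :: "real ^ 'k"
  assumes om: "om > 0" "om\<^sup>2 * (1 + X \<bullet> X) = 1"
    and K: "CARD('k) \<ge> 3" and m: "m = (real CARD('k) - 1) / 2"
    and eqs: "Y = p + om\<^sup>2 *\<^sub>R outer v X" "tau = X \<bullet> v" "G = v + p *v X"
    "H = 2 *\<^sub>R outer X v + (X \<bullet> X) *\<^sub>R p - outer G X - tau *\<^sub>R mat 1"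
    "Xi = (X \<bullet> X) *\<^sub>R v - tau *\<^sub>R X"
    "n = v \<bullet> v + tau\<^sup>2" "q = (X \<bullet> X) * (v \<bullet> v) - tau\<^sup>2"
    "dn = 2 *\<^sub>R (p *v v) + (2 * tau) *\<^sub>R G"
    "dq = (2 * (v \<bullet> v)) *\<^sub>R X + (2 * (X \<bullet> X)) *\<^sub>R (p *v v) - (2 * tau) *\<^sub>R G"
  shows "0 \<le> (Y \<bullet> Y + (Y *v X) \<bullet> (Y *v X)) / om - (m\<^sup>2 + 1) * om * (v \<bullet> v)
    + (m * (real CARD('k) * n * om + om * (X \<bullet> dn) - (X \<bullet> X) * om^3 * n)
       + (om^3 * (H \<bullet> transpose H - (trace H)\<^sup>2) - 3 * om^5 * (Xi \<bullet> (H *v X) - (Xi \<bullet> X) * trace H)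
          + om^3 * (real CARD('k) * q + X \<bullet> dq) - 3 * om^5 * (X \<bullet> X) * q) / (real CARD('k) - 2))"
proof -
  obtain r e where e: "e \<bullet> e = 1" and X: "X = r *\<^sub>R e"
  proof (cases "X = 0")
    case True
    \<comment> \<open>At the origin any unit vector serves as radial direction, with r = 0.\<close>
    then show ?thesis using that[of "axis undefined 1" 0] by (simp add: inner_axis_axis)
  next
    case False
    then show ?thesis using that[of "X /\<^sub>R norm X" "norm X"]
      by (simp add: power2_norm_eq_inner[symmetric] power2_eq_square)
  qed
  have "om\<^sup>2 * (1 + r\<^sup>2) = 1" using om(2) by (simp add: X e power2_eq_square)
  with e om(1) interpret radial_splitting p e v r om by unfold_locales
  from hardy_integrand_nonneg_polar[OF K m X eqs] show ?thesis .
qed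


section \<open>The weighted Hardy inequality\<close>

lemma smooth_const: "smooth (\<lambda>x. c)"
  by (simp add: smooth_def Ck_const)

lemma smooth_add: "smooth f \<Longrightarrow> smooth g \<Longrightarrow> smooth (\<lambda>x. f x + g x)"
  by (simp add: smooth_def Ck_add)

lemma smooth_mult: "smooth f \<Longrightarrow> smooth g \<Longrightarrow> smooth (\<lambda>x. f x * g x :: real)"
  by (simp add: smooth_def bounded_bilinear.Ck_prod[OF bounded_bilinear_mult])

lemma smooth_diff: "smooth f \<Longrightarrow> smooth g \<Longrightarrow> smooth (\<lambda>x. f x - g x :: real)"
  using smooth_add[OF _ smooth_mult[OF smooth_const[of "-1"]], of f g] by simp

lemma smooth_sum: "(\<And>i. i \<in> I \<Longrightarrow> smooth (f i)) \<Longrightarrow> smooth (\<lambda>x. \<Sum>i\<in>I. f i x)"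
  by (simp add: smooth_def Ck_sum)

lemma smooth_power: "smooth f \<Longrightarrow> smooth (\<lambda>x. f x ^ n :: real)"
  by (induction n) (simp_all add: smooth_const smooth_mult)

lemmas smooth_intros = smooth_const smooth_add smooth_diff smooth_mult smooth_sum smooth_power smooth_differentiable(2)

lemma smooth_has_derivative: "smooth f \<Longrightarrow> (f has_derivative frechet_derivative f (at z)) (at z)"
  using smooth_differentiable(1) frechet_derivative_works by blast

lemma frechet_derivative_add:
  "smooth f \<Longrightarrow> smooth g \<Longrightarrow>
    frechet_derivative (\<lambda>x. f x + g x) (at z) h = frechet_derivative f (at z) h + frechet_derivative g (at z) h"
  using frechet_derivative_at[OF has_derivative_add[OF smooth_has_derivative smooth_has_derivative], symmetric]
  by metis

lemma frechet_derivative_diff: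
  "smooth f \<Longrightarrow> smooth g \<Longrightarrow>
    frechet_derivative (\<lambda>x. f x - g x) (at z) h = frechet_derivative f (at z) h - frechet_derivative g (at z) h"
  using frechet_derivative_at[OF has_derivative_diff[OF smooth_has_derivative smooth_has_derivative], symmetric]
  by metis

lemma frechet_derivative_mult:
  "smooth f \<Longrightarrow> smooth g \<Longrightarrow> frechet_derivative (\<lambda>x. f x * g x :: real) (at z) h
     = f z * frechet_derivative g (at z) h + frechet_derivative f (at z) h * g z"
  using frechet_derivative_at[OF has_derivative_mult[OF smooth_has_derivative smooth_has_derivative], symmetric]
  by metis

lemma frechet_derivative_sum:
  "(\<And>i. i \<in> I \<Longrightarrow> smooth (f i)) \<Longrightarrow>
    frechet_derivative (\<lambda>x. \<Sum>i\<in>I. f i x) (at z) h = (\<Sum>i\<in>I. frechet_derivative (f i) (at z) h)"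
  using frechet_derivative_at[OF has_derivative_sum[of I f, OF smooth_has_derivative], symmetric]
  by metis

lemma frechet_derivative_power:
  fixes f :: "'a::real_normed_vector \<Rightarrow> real"
  assumes "smooth f"
  shows "frechet_derivative (\<lambda>x. f x ^ n) (at z) h = real n * f z ^ (n - 1) * frechet_derivative f (at z) h"
proof -
  note has_derivative_power[OF smooth_has_derivative[OF assms]]
  from frechet_derivative_at[OF this, symmetric] show ?thesis by (simp add: mult_ac)
qed

lemmas frechet_derivative_rules = frechet_derivative_add frechet_derivative_diff frechet_derivative_mult
  frechet_derivative_sum frechet_derivative_power frechet_derivative_const

text \<open>The domain is abstract: derivatives are taken only along directions \<open>ep l\<close>
  dual to the functions \<open>x j\<close>. The helicoid parameter s can thus stay among the
  integration variables, and no iterated integral is required. \<open>dom\<close> is the derivative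
  of (1 + |x|^2)^(-1/2).\<close>

locale hardy_fields =
  fixes x v :: "'k::finite \<Rightarrow> 'a::euclidean_space \<Rightarrow> real" and om :: "'a \<Rightarrow> real" and ep :: "'k \<Rightarrow> 'a"
  assumes sx: "\<And>j. smooth (x j)" and sv: "\<And>j. smooth (v j)" and so: "smooth om"
    and dx: "\<And>j l z. frechet_derivative (x j) (at z) (ep l) = (if j = l then 1 else 0)"
    and dom: "\<And>l z. frechet_derivative om (at z) (ep l) = - (om z ^ 3 * x l z)"
begin

abbreviation "dd f l z \<equiv> frechet_derivative f (at z) (ep l)"

text \<open>
  \<open>xi\<close> is the part of \<open>v\<close> tangential to the spheres around the origin, scaled by \<open>r2\<close> to be smooth at
  the origin. Up to second derivatives, which cancel, the divergence of \<open>U\<close> is a sum of \<open>2 \<times> 2\<close>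
  minors of the Jacobian of \<open>xi\<close>.
\<close>

definition "r2 z = (\<Sum>j\<in>UNIV. x j z * x j z)"
definition "t z = (\<Sum>j\<in>UNIV. x j z * v j z)"
definition "nv z = (\<Sum>j\<in>UNIV. v j z * v j z)"
definition "xi j z = r2 z * v j z - t z * x j z"
definition "N z = nv z + t z * t z"
definition "R z = r2 z * nv z - t z * t z"
definition "U l z = (\<Sum>j\<in>UNIV. xi j z * dd (xi l) j z) - xi l z * (\<Sum>j\<in>UNIV. dd (xi j) j z)"

lemma smooths: "smooth r2" "smooth t" "smooth nv" "smooth (xi j)" "smooth N" "smooth R" "smooth (U l)"
proof -
  show r2: "smooth r2" and t: "smooth t" and nv: "smooth nv"
    unfolding r2_def[abs_def] t_def[abs_def] nv_def[abs_def] by (intro smooth_intros sx sv)+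
  show xi: "smooth (xi j)" for j
    unfolding xi_def[abs_def] by (intro smooth_intros sx sv r2 t)
  show "smooth N" "smooth R" "smooth (U l)"
    unfolding N_def[abs_def] R_def[abs_def] U_def[abs_def] by (intro smooth_intros sx sv r2 t nv xi)+
qed

lemma dd_r2: "dd r2 l z = 2 * x l z"
  unfolding r2_def[abs_def]
  by (simp add: frechet_derivative_rules smooth_intros sx dx) (simp add: if_distrib cong: if_cong)

lemma dd_t: "dd t l z = v l z + (\<Sum>j\<in>UNIV. x j z * dd (v j) l z)"
proof -
  have "dd t l z = (\<Sum>j\<in>UNIV. (if j = l then v j z else 0) + x j z * dd (v j) l z)"
    unfolding t_def[abs_def] by (simp add: frechet_derivative_rules smooth_intros sx sv dx) (rule sum.cong, auto)
  then show ?thesis by (simp add: sum.distrib)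
qed

lemma dd_nv: "dd nv l z = 2 * (\<Sum>j\<in>UNIV. v j z * dd (v j) l z)"
  unfolding nv_def[abs_def] 
  by (simp add: frechet_derivative_rules smooth_intros sv sum_distrib_left)

lemma dd_xi: "dd (xi j) l z = 2 * x l z * v j z + r2 z * dd (v j) l z - dd t l z * x j z
    - t z * (if j = l then 1 else 0)"
  unfolding xi_def[abs_def] by (simp add: frechet_derivative_rules smooth_intros smooths sx sv dx dd_r2)

text \<open>The second derivatives of \<open>xi\<close> form two double sums of opposite sign, which
  agree after exchanging the indices and using symmetry of second derivatives.\<close>

lemma div_U: "(\<Sum>l\<in>UNIV. dd (U l) l z)
  = (\<Sum>l\<in>UNIV. \<Sum>j\<in>UNIV. dd (xi j) l z * dd (xi l) j z) - (\<Sum>j\<in>UNIV. dd (xi j) j z)\<^sup>2"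
proof -
  have "dd (U l) l z = (\<Sum>j\<in>UNIV. dd (xi j) l z * dd (xi l) j z) + (\<Sum>j\<in>UNIV. xi j z * dd (dd (xi l) j) l z)
     - (dd (xi l) l z * (\<Sum>j\<in>UNIV. dd (xi j) j z) + (\<Sum>j\<in>UNIV. xi l z * dd (dd (xi j) j) l z))" for l
    unfolding U_def[abs_def]
    by (simp add: frechet_derivative_rules smooth_intros smooths sum.distrib sum_distrib_left)
  then have "(\<Sum>l\<in>UNIV. dd (U l) l z) = (\<Sum>l\<in>UNIV. \<Sum>j\<in>UNIV. dd (xi j) l z * dd (xi l) j z)
      + (\<Sum>l\<in>UNIV. \<Sum>j\<in>UNIV. xi j z * dd (dd (xi l) j) l z)
     - (\<Sum>l\<in>UNIV. dd (xi l) l z) * (\<Sum>j\<in>UNIV. dd (xi j) j z)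
     - (\<Sum>l\<in>UNIV. \<Sum>j\<in>UNIV. xi l z * dd (dd (xi j) j) l z)"
    by (simp add: sum.distrib sum_subtractf sum_distrib_right)
  moreover have "(\<Sum>l\<in>UNIV. \<Sum>j\<in>UNIV. xi l z * dd (dd (xi j) j) l z)
      = (\<Sum>l\<in>UNIV. \<Sum>j\<in>UNIV. xi j z * dd (dd (xi l) j) l z)"
  proof -
    have "dd (dd (xi j) j) l z = dd (dd (xi j) l) j z" for j l
      using smooths(4)[of j] by (intro frechet_derivative_commute) (simp add: smooth_def)
    then show ?thesis by (subst sum.swap) simp
  qed
  ultimately show ?thesis by (simp add: power2_eq_square)
qed

text \<open>
  The first summand comes from the ground state \<open>om\<^sup>m\<close> of the radial Hardy inequality. In the second one,
  \<open>R x\<close> compensates for the non-tangential minors in the divergence of \<open>U\<close>, and the factor \<open>om\<^sup>3\<close> makes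
  the relative weight of the minors \<open>c (r\<^sup>2 om\<^sup>2)\<^sup>2\<close>.
\<close>

definition "Z m c l z = m * (om z * (N z * x l z)) + c * (om z ^ 3 * (U l z + R z * x l z))"

lemma smooth_Z: "smooth (Z m c l)"
  unfolding Z_def[abs_def] by (intro smooth_intros smooths sx so)

lemma div_mult_x:
  assumes "smooth f"
  shows "(\<Sum>l\<in>UNIV. dd (\<lambda>z. f z * x l z) l z) = real CARD('k) * f z + (\<Sum>l\<in>UNIV. x l z * dd f l z)"
  using assms by (simp add: frechet_derivative_rules smooth_intros sx dx sum.distrib mult.commute)

lemma div_Z: "(\<Sum>l\<in>UNIV. dd (Z m c l) l z) =
   m * (real CARD('k) * N z * om z + om z * (\<Sum>l\<in>UNIV. x l z * dd N l z) - r2 z * om z ^ 3 * N z)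
   + c * (om z ^ 3 * (\<Sum>l\<in>UNIV. dd (U l) l z) - 3 * om z ^ 5 * (\<Sum>l\<in>UNIV. x l z * U l z)
       + om z ^ 3 * (real CARD('k) * R z + (\<Sum>l\<in>UNIV. x l z * dd R l z)) - 3 * om z ^ 5 * r2 z * R z)"
proof -
  have "dd (Z m c l) l z = m * (om z * dd (\<lambda>z. N z * x l z) l z - om z ^ 3 * N z * (x l z * x l z))
    + c * (om z ^ 3 * dd (U l) l z - 3 * om z ^ 5 * (x l z * U l z)
        + om z ^ 3 * dd (\<lambda>z. R z * x l z) l z - 3 * om z ^ 5 * R z * (x l z * x l z))" for l
    unfolding Z_def[abs_def]
    by (simp add: frechet_derivative_rules smooth_intros smooths sx so dom)
      (simp add: algebra_simps eval_nat_numeral)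
  then have "(\<Sum>l\<in>UNIV. dd (Z m c l) l z) = 
     m * (om z * (\<Sum>l\<in>UNIV. dd (\<lambda>z. N z * x l z) l z) - om z ^ 3 * N z * r2 z)
    + c * (om z ^ 3 * (\<Sum>l\<in>UNIV. dd (U l) l z) - 3 * om z ^ 5 * (\<Sum>l\<in>UNIV. x l z * U l z)
        + om z ^ 3 * (\<Sum>l\<in>UNIV. dd (\<lambda>z. R z * x l z) l z) - 3 * om z ^ 5 * R z * r2 z)"
    unfolding r2_def by (simp only: sum.distrib sum_subtractf sum_distrib_left[symmetric])
  then show ?thesis
    unfolding div_mult_x[OF smooths(5)] div_mult_x[OF smooths(6)] by (simp add: algebra_simps)
qed

text \<open>The inequality is delivered as a pointwise lower bound \<open>D\<close> with integral
  zero, namely minus the divergence of \<open>Z\<close>. In this form it says nothing yet about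
  integrability of the right-hand side.\<close>

lemma weighted_hardy:
  assumes K: "CARD('k) \<ge> 3" and om: "\<And>z. om z > 0" "\<And>z. (om z)\<^sup>2 * (1 + (\<Sum>j\<in>UNIV. x j z * x j z)) = 1"
    and S: "compact S" "\<And>j z. z \<notin> S \<Longrightarrow> v j z = 0"
  defines "X \<equiv> \<lambda>z. \<chi> j. x j z" and "V \<equiv> \<lambda>z. \<chi> j. v j z" and "p \<equiv> \<lambda>z. \<chi> l j. frechet_derivative (v j) (at z) (ep l)"
  defines "y \<equiv> \<lambda>z. p z + (om z)\<^sup>2 *\<^sub>R outer (V z) (X z)"
  obtains D where "integrable lborel D" "integral\<^sup>L lborel D = 0"
    "\<And>z. D z \<le> (y z \<bullet> y z + (y z *v X z) \<bullet> (y z *v X z)) / om z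
      - (((real CARD('k) - 1) / 2)\<^sup>2 + 1) * om z * (V z \<bullet> V z)"
proof -
  define m where "m = (real CARD('k) - 1) / 2"
  define c where "c = 1 / (real CARD('k) - 2)"
  define D where "D z = - (\<Sum>l\<in>UNIV. dd (Z m c l) l z)" for z
  have xi0: "xi j z = 0" "N z = 0" "R z = 0" if "z \<notin> S" for j z
    using S(2)[OF that] by (simp_all add: xi_def t_def N_def R_def nv_def)
  have Z: "integrable lborel (\<lambda>z. dd (Z m c l) l z)" "integral\<^sup>L lborel (\<lambda>z. dd (Z m c l) l z) = 0" for l
  proof -
    have "Ck 1 (Z m c l)" using smooth_Z unfolding smooth_def by blast
    moreover have "Z m c l z = 0" if "z \<notin> S" for z
      using xi0[OF that] by (simp add: Z_def U_def)
    ultimately show "integrable lborel (\<lambda>z. dd (Z m c l) l z)" "integral\<^sup>L lborel (\<lambda>z. dd (Z m c l) l z) = 0"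
      by (intro integral_directional_derivative_eq_0[OF _ S(1)]; simp)+
  qed
  show ?thesis
  proof (rule that[of D])
    show "integrable lborel D" "integral\<^sup>L lborel D = 0"
      unfolding D_def[abs_def] using Z by (simp_all add: Bochner_Integration.integral_sum)
  next
    fix z
    \<comment> \<open>From here on the fields and their derivatives at \<open>z\<close> are matched
      with the algebraic expressions in \<open>hardy_integrand_nonneg\<close>.\<close>
    define H where "H = (\<chi> l j. dd (xi j) l z)"
    define Xi where "Xi = (\<chi> j. xi j z)"
    define G where "G = (\<chi> l. dd t l z)"
    define dn where "dn = (\<chi> l. dd N l z)"
    define dq where "dq = (\<chi> l. dd R l z)"
    have r2: "r2 z = X z \<bullet> X z" by (simp add: r2_def X_def inner_vec_def)
    have t: "t z = X z \<bullet> V z" by (simp add: t_def X_def V_def inner_vec_def)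
    have nv: "nv z = V z \<bullet> V z" by (simp add: nv_def V_def inner_vec_def)
    have G: "G = V z + p z *v X z"
      by (simp add: G_def V_def p_def X_def vec_eq_iff matrix_vector_mult_def dd_t mult.commute)
    have H: "H = 2 *\<^sub>R outer (X z) (V z) + (X z \<bullet> X z) *\<^sub>R p z - outer G (X z) - t z *\<^sub>R mat 1"
      by (simp add: H_def dd_xi r2[symmetric] vec_eq_iff outer_def mat_def G_def) (simp add: X_def V_def p_def)
    have Xi: "Xi = (X z \<bullet> X z) *\<^sub>R V z - t z *\<^sub>R X z"
      by (simp add: Xi_def xi_def r2[symmetric] vec_eq_iff) (simp add: X_def V_def)
    have dn: "dn = 2 *\<^sub>R (p z *v V z) + (2 * t z) *\<^sub>R G"
      unfolding dn_def N_def[abs_def]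
      by (simp add: frechet_derivative_rules smooth_intros smooths dd_nv vec_eq_iff matrix_vector_mult_def G_def)
        (simp add: V_def p_def mult.commute)
    have dq: "dq = (2 * (V z \<bullet> V z)) *\<^sub>R X z + (2 * (X z \<bullet> X z)) *\<^sub>R (p z *v V z) - (2 * t z) *\<^sub>R G"
      unfolding dq_def R_def[abs_def] nv[symmetric] r2[symmetric]
      by (simp add: frechet_derivative_rules smooth_intros smooths dd_nv dd_r2 vec_eq_iff matrix_vector_mult_def G_def)
        (simp add: V_def X_def p_def mult.commute)
    have HH: "(\<Sum>l\<in>UNIV. dd (U l) l z) = H \<bullet> transpose H - (trace H)\<^sup>2"
      unfolding div_U by (simp add: H_def inner_vec_def transpose_def trace_def)
    have U: "(\<Sum>l\<in>UNIV. x l z * U l z) = Xi \<bullet> (H *v X z) - (Xi \<bullet> X z) * trace H"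
    proof -
      have "(\<Sum>l\<in>UNIV. x l z * U l z) = (\<Sum>l\<in>UNIV. \<Sum>j\<in>UNIV. xi j z * (dd (xi l) j z * x l z))
         - (\<Sum>l\<in>UNIV. xi l z * x l z * (\<Sum>j\<in>UNIV. dd (xi j) j z))"
        by (simp add: U_def right_diff_distrib sum_subtractf sum_distrib_left mult_ac)
      also have "(\<Sum>l\<in>UNIV. \<Sum>j\<in>UNIV. xi j z * (dd (xi l) j z * x l z)) = Xi \<bullet> (H *v X z)"
        by (subst sum.swap) (simp add: Xi_def H_def X_def inner_vec_def matrix_vector_mult_def sum_distrib_left)
      finally show ?thesis by (simp add: Xi_def H_def X_def inner_vec_def trace_def sum_distrib_right)
    qed
    have "0 \<le> (y z \<bullet> y z + (y z *v X z) \<bullet> (y z *v X z)) / om z - (m\<^sup>2 + 1) * om z * (V z \<bullet> V z)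
      + (m * (real CARD('k) * N z * om z + om z * (X z \<bullet> dn) - (X z \<bullet> X z) * om z^3 * N z)
       + (om z^3 * (H \<bullet> transpose H - (trace H)\<^sup>2) - 3 * om z^5 * (Xi \<bullet> (H *v X z) - (Xi \<bullet> X z) * trace H)
          + om z^3 * (real CARD('k) * R z + X z \<bullet> dq) - 3 * om z^5 * (X z \<bullet> X z) * R z) / (real CARD('k) - 2))"
    proof (rule hardy_integrand_nonneg[OF om(1) _ K m_def _ t G H Xi _ _ dn dq])
      show "(om z)\<^sup>2 * (1 + X z \<bullet> X z) = 1" using om(2)[of z] by (simp add: X_def inner_vec_def)
    qed (simp_all add: y_def N_def R_def r2 nv power2_eq_square)
    also have "\<dots> = (y z \<bullet> y z + (y z *v X z) \<bullet> (y z *v X z)) / om z - (m\<^sup>2 + 1) * om z * (V z \<bullet> V z) - D z"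
      unfolding D_def div_Z HH U r2 c_def by (simp add: dn_def dq_def X_def inner_vec_def)
    finally show "D z \<le> (y z \<bullet> y z + (y z *v X z) \<bullet> (y z *v X z)) / om z
      - (((real CARD('k) - 1) / 2)\<^sup>2 + 1) * om z * (V z \<bullet> V z)"
      unfolding m_def by simp
  qed
qed

end


section \<open>The second variation of a generalized helicoid\<close>

lemma Ck_bounded_linear_compose:
  "bounded_linear L \<Longrightarrow> Ck n g \<Longrightarrow> Ck n (\<lambda>x. L (g x))"
proof (induction n arbitrary: g)
  case 0
  then show ?case by (auto intro: bounded_linear.continuous_on)
next
  case (Suc n)
  show ?case
    using Suc.prems
    by (intro Ck_SucI[OF bounded_linear.has_derivative[OF Suc.prems(1) Ck_Suc_has_derivative]] Suc.IH) auto
qed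

text \<open>The induction is over all exponents at once, because differentiation lowers
  \<open>c\<close> by one.\<close>

lemma Ck_powr:
  fixes f :: "'a::real_normed_vector \<Rightarrow> real"
  assumes "Ck n f" and pos: "\<And>x. f x > 0"
  shows "Ck n (\<lambda>x. f x powr c)"
  using assms(1)
proof (induction n arbitrary: c)
  case 0
  then show ?case using pos by (auto intro!: continuous_intros simp: less_imp_neq[symmetric])
next
  case (Suc n)
  show ?case
  proof (rule Ck_SucI)
    show "((\<lambda>x. f x powr c) has_derivative (\<lambda>h. c * f x powr (c - 1) * frechet_derivative f (at x) h)) (at x)" for x
      using has_derivative_compose[OF Ck_Suc_has_derivative[OF Suc.prems]
          has_real_derivative_powr[OF pos, unfolded has_field_derivative_def]] .
    show "Ck n (\<lambda>x. c * f x powr (c - 1) * frechet_derivative f (at x) v)" for v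
      using Suc.prems by (intro bounded_bilinear.Ck_prod[OF bounded_bilinear_mult] Ck_const Suc.IH Ck_Suc_D[OF Suc.prems]) simp
  qed
qed

lemma sum_Basis_vec_prod_real:
  fixes f :: "(real ^ 'k) \<times> real \<Rightarrow> 'b::comm_monoid_add"
  shows "(\<Sum>a\<in>Basis. f a) = (\<Sum>j\<in>UNIV. f (axis j 1, 0)) + f (0, 1)"
proof -
  have B: "(Basis :: (real ^ 'k) set) = range (\<lambda>j. axis j 1)" by (auto simp: Basis_vec_def)
  have i: "inj (\<lambda>j :: 'k. axis j (1::real))" by (auto intro!: injI simp: axis_eq_axis)
  have "(\<Sum>a\<in>Basis. f a) = (\<Sum>a\<in>(\<lambda>u. (u, 0)) ` Basis. f a) + (\<Sum>a\<in>(\<lambda>u. (0, u)) ` Basis. f a)"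
    unfolding Basis_prod_def by (rule sum.union_disjoint) auto
  also have "(\<Sum>a\<in>(\<lambda>u. (u, 0)) ` Basis. f a) = (\<Sum>a\<in>Basis. f (a, 0))"
    by (rule sum.reindex[unfolded o_def]) (auto intro: inj_onI)
  also have "\<dots> = (\<Sum>j\<in>UNIV. f (axis j 1, 0))"
    unfolding B by (rule sum.reindex[OF i, unfolded o_def])
  finally show ?thesis by simp
qed

text \<open>The coordinate vectors are orthogonal, so only the identity permutation contributes, and
  only the s-direction has length other than 1.\<close>

lemma gram_det_helicoid:
  fixes lam :: "real ^ 'k"
  shows "gram_det (helicoid lam) z = 1 + (\<Sum>j\<in>UNIV. (lam $ j * fst z $ j)\<^sup>2)" (is "_ = ?w")
proof -
  let ?B = "Basis :: ((real ^ 'k) \<times> real) set"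
  let ?I = "\<lambda>a b. helicoid_deriv lam z a \<bullet> helicoid_deriv lam z b"
  have off: "?I a b = 0" if "a \<in> ?B" "b \<in> ?B" "a \<noteq> b" for a b
    using that unfolding inner_helicoid_deriv by (auto simp: Basis_prod_def inner_Basis split: if_splits)
  have "gram_det (helicoid lam) z
      = (\<Sum>p | p permutes ?B. if p = id then (\<Prod>a\<in>?B. ?I a a) else 0)"
    unfolding gram_det_def frechet_derivative_helicoid
  proof (rule sum.cong[OF refl])
    fix p assume p: "p \<in> {p. p permutes ?B}"
    show "of_int (sign p) * (\<Prod>a\<in>?B. ?I a (p a)) = (if p = id then (\<Prod>a\<in>?B. ?I a a) else 0)"
    proof (cases "p = id")
      case False
      then obtain a where "p a \<noteq> a" by (auto simp: fun_eq_iff)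
      then have a: "a \<in> ?B" "p a \<in> ?B"
        using p by (auto simp: permutes_in_image dest: permutes_not_in)
      have "?I a (p a) = 0" using off[OF a] \<open>p a \<noteq> a\<close> by auto
      then have "(\<Prod>a\<in>?B. ?I a (p a)) = 0" using a(1) by (intro prod_zero) auto
      then show ?thesis using False by simp
    qed simp
  qed
  also have "\<dots> = (\<Prod>a\<in>?B. ?I a a)"
    using finite_permutations[of ?B] by (simp add: permutes_id)
  also have "\<dots> = (\<Prod>a\<in>(\<lambda>u. (u, 0)) ` Basis. ?I a a) * (\<Prod>a\<in>(\<lambda>u. (0, u)) ` Basis. ?I a a)"
    unfolding Basis_prod_def by (rule prod.union_disjoint) auto
  also have "(\<Prod>a\<in>(\<lambda>u. (u, 0)) ` Basis. ?I a a) = 1"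
    by (rule prod.neutral) (auto simp: inner_helicoid_deriv inner_Basis)
  finally show ?thesis by (simp add: inner_helicoid_deriv)
qed

section \<open>Normal fields along the helicoid in coordinates\<close>

locale helicoid_normal_field =
  fixes lam :: "real ^ 'k" and V :: "(real ^ 'k) \<times> real \<Rightarrow> (complex ^ 'k) \<times> real"
  assumes lam: "\<And>j. lam $ j > 0" and sV: "smooth V" and nV: "normal_field (helicoid lam) V"
begin

definition "E j z = exp (\<i> * complex_of_real (lam $ j * snd z))" for z :: "(real ^ 'k) \<times> real"
definition "x j z = lam $ j * fst z $ j" for z :: "(real ^ 'k) \<times> real"
definition "w z = 1 + (\<Sum>j\<in>UNIV. x j z * x j z)"
definition "om z = w z powr (- (1 / 2))"
definition "v j z = (fst (V z) $ j) \<bullet> (\<i> * E j z)"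

text \<open>\<open>ep l\<close> is normalised so that differentiation along it is the partial derivative in \<open>x l\<close>.\<close>

definition "ep l = (axis l (1 / lam $ l), 0 :: real)"
definition "normal_vec z y = ((\<chi> j. \<i> * of_real (y j) * E j z), - (\<Sum>j\<in>UNIV. x j z * y j))"
  for z :: "(real ^ 'k) \<times> real" and y :: "'k \<Rightarrow> real"

lemma w_pos: "w z > 0"
  unfolding w_def by (intro add_pos_nonneg sum_nonneg) auto

lemma om: "om z > 0" "(om z)\<^sup>2 * w z = 1" "sqrt (w z) = 1 / om z"
proof -
  show p: "om z > 0" unfolding om_def using w_pos[of z] by simp
  have s: "om z = 1 / sqrt (w z)" 
    unfolding om_def using w_pos[of z] by (simp add: powr_minus_divide powr_half_sqrt)
  then show "sqrt (w z) = 1 / om z" by simp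
  show "(om z)\<^sup>2 * w z = 1" unfolding s using w_pos[of z] by (simp add: power_divide)
qed

lemma smooths: "smooth (x j)" "smooth w" "smooth om" "smooth (v j)"
proof -
  have "bounded_linear (\<lambda>z :: (real ^ 'k) \<times> real. lam $ j * fst z $ j)" for j
    by (intro bounded_linear_mult_right[THEN bounded_linear_compose]
        bounded_linear_vec_nth[THEN bounded_linear_compose] bounded_linear_fst)
  then show x: "smooth (x j)" for j
    unfolding x_def[abs_def] smooth_def by (simp add: Ck_bounded_linear)
  show w: "smooth w" unfolding w_def[abs_def] by (intro smooth_intros x)
  then show "smooth om"
    unfolding om_def[abs_def] smooth_def by (simp add: Ck_powr w_pos)
  have 1: "bounded_linear (\<lambda>y :: (complex ^ 'k) \<times> real. fst y $ j)"
    by (intro bounded_linear_vec_nth[THEN bounded_linear_compose] bounded_linear_fst)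
  have 2: "bounded_linear (\<lambda>z :: (real ^ 'k) \<times> real. \<i> * complex_of_real (lam $ j * snd z))"
    by (intro bounded_linear_mult_right[THEN bounded_linear_compose]
        bounded_linear_of_real[THEN bounded_linear_compose] bounded_linear_snd)
  have "Ck n V" for n using sV unfolding smooth_def by blast
  then show "smooth (v j)"
    unfolding v_def[abs_def] E_def smooth_def
    by (intro allI bounded_bilinear.Ck_prod[OF bounded_bilinear_inner] Ck_bounded_linear_compose[OF 1]
        bounded_bilinear.Ck_prod[OF bounded_bilinear_mult] Ck_const Ck_exp_linear[OF 2])
qed

lemma dx: "frechet_derivative (x j) (at z) (ep l) = (if j = l then 1 else 0)"
proof -
  have "bounded_linear (\<lambda>z :: (real ^ 'k) \<times> real. lam $ j * fst z $ j)"
    by (intro bounded_linear_mult_right[THEN bounded_linear_compose]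
        bounded_linear_vec_nth[THEN bounded_linear_compose] bounded_linear_fst)
  from frechet_derivative_at[OF bounded_linear_imp_has_derivative[OF this], of z, symmetric]
  show ?thesis using lam[of l] by (auto simp: x_def[abs_def] ep_def axis_def)
qed

text \<open>Obtained by differentiating the identity
  \<open>(om z)\<^sup>2 * w z = 1\<close>.\<close>

lemma dom: "frechet_derivative om (at z) (ep l) = - (om z ^ 3 * x l z)"
proof -
  have "frechet_derivative w (at z) (ep l) = 2 * x l z"
    unfolding w_def[abs_def] by (simp add: frechet_derivative_rules smooth_intros smooths dx)
      (simp add: if_distrib cong: if_cong)
  then have "frechet_derivative (\<lambda>z. (om z)\<^sup>2 * w z) (at z) (ep l)
     = 2 * om z * w z * frechet_derivative om (at z) (ep l) + 2 * (om z)\<^sup>2 * x l z"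
    by (simp add: frechet_derivative_rules smooth_intros smooths)
  moreover have "frechet_derivative (\<lambda>z. (om z)\<^sup>2 * w z) (at z) (ep l) = 0"
    unfolding om by (simp add: frechet_derivative_const)
  ultimately have "0 = om z * (w z * frechet_derivative om (at z) (ep l) + om z * x l z)"
    by (simp add: algebra_simps power2_eq_square)
  then have 0: "w z * frechet_derivative om (at z) (ep l) = - (om z * x l z)" using om(1)[of z] by simp
  have "frechet_derivative om (at z) (ep l) = ((om z)\<^sup>2 * w z) * frechet_derivative om (at z) (ep l)"
    unfolding om by simp
  also have "\<dots> = (om z)\<^sup>2 * (w z * frechet_derivative om (at z) (ep l))" by simp
  finally show ?thesis unfolding 0 by (simp add: power2_eq_square power3_eq_cube)
qed

text \<open>\<open>E j z\<close> has modulus 1, so multiplication by it is an isometry of the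
  complex plane.\<close>

lemma inner_E: "((of_real a + \<i> * of_real b) * E j z) \<bullet> ((of_real c + \<i> * of_real d) * E j z) = a * c + b * d"
proof -
  let ?t = "lam $ j * snd z"
  have "E j z = cis ?t" by (simp add: E_def cis_conv_exp)
  then have "((of_real a + \<i> * of_real b) * E j z) \<bullet> ((of_real c + \<i> * of_real d) * E j z)
      = (a * cos ?t - b * sin ?t) * (c * cos ?t - d * sin ?t) + (a * sin ?t + b * cos ?t) * (c * sin ?t + d * cos ?t)"
    by (simp add: inner_complex_def)
  also have "\<dots> = (a * c + b * d) * ((cos ?t)\<^sup>2 + (sin ?t)\<^sup>2)"
    by algebra
  finally show ?thesis by simp
qed

lemma inner_helicoid_deriv_normal_vec:
  "helicoid_deriv lam z h \<bullet> normal_vec z y = 0"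
proof -
  have "helicoid_deriv lam z h \<bullet> normal_vec z y
    = (\<Sum>j\<in>UNIV. ((of_real (fst h $ j) + \<i> * of_real (lam $ j * snd h * fst z $ j)) * E j z) \<bullet>
        ((of_real 0 + \<i> * of_real (y j)) * E j z)) - snd h * (\<Sum>j\<in>UNIV. x j z * y j)"
    by (simp add: helicoid_deriv_def normal_vec_def inner_prod_def inner_vec_def E_def)
  also have "\<dots> = 0"
    unfolding inner_E by (simp add: x_def sum_distrib_left mult_ac)
  finally show ?thesis .
qed

lemma inner_normal_vec: "normal_vec z y \<bullet> normal_vec z y'
  = (\<Sum>j\<in>UNIV. y j * y' j) + (\<Sum>j\<in>UNIV. x j z * y j) * (\<Sum>j\<in>UNIV. x j z * y' j)"
proof -
  have "normal_vec z y \<bullet> normal_vec z y' = (\<Sum>j\<in>UNIV. ((of_real 0 + \<i> * of_real (y j)) * E j z) \<bullet>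
        ((of_real 0 + \<i> * of_real (y' j)) * E j z)) + (\<Sum>j\<in>UNIV. x j z * y j) * (\<Sum>j\<in>UNIV. x j z * y' j)"
    by (simp add: normal_vec_def inner_prod_def inner_vec_def)
  then show ?thesis unfolding inner_E by simp
qed

lemma normal_vec_in: "normal_vec z y \<in> normal_subspace (helicoid lam) z"
  unfolding normal_subspace_def tangent_space_def frechet_derivative_helicoid
  by (auto simp: orthogonal_comp_def orthogonal_def inner_helicoid_deriv_normal_vec)

text \<open>Orthogonality to the u_j-direction leaves only a multiple of \<open>\<i> * E j z\<close>
  in the j-th component; orthogonality to the s-direction then determines the real
  component.\<close>

lemma V_eq: "V z = normal_vec z (\<lambda>j. v j z)"
proof -
  have ort: "helicoid_deriv lam z h \<bullet> V z = 0" for h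
  proof -
    have "V z \<in> normal_subspace (helicoid lam) z" using nV unfolding normal_field_def by (rule spec)
    then show ?thesis
      unfolding normal_subspace_def tangent_space_def frechet_derivative_helicoid orthogonal_comp_def orthogonal_def
      by blast
  qed
  have fst: "fst (V z) $ j = \<i> * of_real (v j z) * E j z" for j
  proof -
    have "E j z \<bullet> fst (V z) $ j = helicoid_deriv lam z (axis j 1, 0) \<bullet> V z"
    proof -
      have "helicoid_deriv lam z (axis j 1, 0) \<bullet> V z = (\<Sum>i\<in>UNIV. (if i = j then E j z \<bullet> fst (V z) $ j else 0))"
        unfolding helicoid_deriv_def inner_prod_def inner_vec_def
        by (rule trans[OF _ add_0_right], intro arg_cong2[of _ _ _ _ "(+)"] sum.cong) (auto simp: E_def axis_def)
      then show ?thesis by simp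
    qed
    then have 0: "E j z \<bullet> fst (V z) $ j = 0" by (simp add: ort)
    let ?t = "lam $ j * snd z"
    have E: "E j z = cis ?t" by (simp add: E_def cis_conv_exp)
    have re: "Re (fst (V z) $ j) * cos ?t + Im (fst (V z) $ j) * sin ?t = 0"
      using 0 by (simp add: E inner_complex_def mult.commute)
    have vj: "v j z = Im (fst (V z) $ j) * cos ?t - Re (fst (V z) $ j) * sin ?t"
      by (simp add: v_def E inner_complex_def)
    have cs: "(cos ?t)\<^sup>2 + (sin ?t)\<^sup>2 = 1" by simp
    show ?thesis
      unfolding complex_eq_iff E vj using re cs
      by (simp; algebra)
  qed
  have "helicoid_deriv lam z (0, 1) \<bullet> V z
    = (\<Sum>j\<in>UNIV. ((of_real 0 + \<i> * of_real (x j z)) * E j z) \<bullet> ((of_real 0 + \<i> * of_real (v j z)) * E j z)) + snd (V z)"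
    by (simp add: helicoid_deriv_def inner_prod_def inner_vec_def fst) (simp add: x_def E_def)
  then have "snd (V z) = - (\<Sum>j\<in>UNIV. x j z * v j z)"
    unfolding inner_E ort by simp
  then show ?thesis by (simp add: normal_vec_def prod_eq_iff vec_eq_iff fst)
qed

text \<open>Differentiating the coefficients \<open>x j\<close> in the last component of V produces
  the vector (0, -v_l). Its normal part has coordinates om^2 v_l x_j, and its tangential part is
  -om^2 v_l times the s-direction.\<close>

lemma normal_deriv_eq:
  "normal_deriv (helicoid lam) V z (ep l)
    = normal_vec z (\<lambda>j. frechet_derivative (v j) (at z) (ep l) + (om z)\<^sup>2 * (v l z * x j z))"
proof -
  have dE: "(E j has_derivative (\<lambda>h. \<i> * of_real (lam $ j * snd h) * E j z)) (at z)" for j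
    using has_derivative_exp_snd[of "lam $ j" z] unfolding E_def[abs_def] .
  let ?d = "\<lambda>j. frechet_derivative (v j) (at z)"
  have dv: "(v j has_derivative ?d j) (at z)" for j by (rule smooth_has_derivative[OF smooths(4)])
  have dx': "(x j has_derivative frechet_derivative (x j) (at z)) (at z)" for j
    by (rule smooth_has_derivative[OF smooths(1)])
  have "((\<lambda>z. \<i> * of_real (v j z) * E j z) has_derivative
      (\<lambda>h. \<i> * of_real (v j z) * (\<i> * of_real (lam $ j * snd h) * E j z) + \<i> * of_real (?d j h) * E j z)) (at z)" for j
    by (intro has_derivative_mult dE has_derivative_mult_right has_derivative_of_real dv)
  moreover have "((\<lambda>z. - (\<Sum>j\<in>UNIV. x j z * v j z)) has_derivative
     (\<lambda>h. - (\<Sum>j\<in>UNIV. x j z * ?d j h + frechet_derivative (x j) (at z) h * v j z))) (at z)"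
    by (intro has_derivative_minus has_derivative_sum has_derivative_mult dx' dv)
  ultimately have "((\<lambda>z. normal_vec z (\<lambda>j. v j z)) has_derivative
     (\<lambda>h. ((\<chi> j. \<i> * of_real (v j z) * (\<i> * of_real (lam $ j * snd h) * E j z) + \<i> * of_real (?d j h) * E j z),
        - (\<Sum>j\<in>UNIV. x j z * ?d j h + frechet_derivative (x j) (at z) h * v j z)))) (at z)"
    unfolding normal_vec_def by (intro has_derivative_Pair has_derivative_vec_lambda)
  then have "(V has_derivative
     (\<lambda>h. ((\<chi> j. \<i> * of_real (v j z) * (\<i> * of_real (lam $ j * snd h) * E j z) + \<i> * of_real (?d j h) * E j z),
        - (\<Sum>j\<in>UNIV. x j z * ?d j h + frechet_derivative (x j) (at z) h * v j z)))) (at z)"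
    unfolding V_eq[symmetric] .
  from frechet_derivative_at[OF this, symmetric]
  have "frechet_derivative V (at z) (ep l) = ((\<chi> j. \<i> * of_real (?d j (ep l)) * E j z),
      - (\<Sum>j\<in>UNIV. x j z * ?d j (ep l)) - v l z)"
    by (simp add: dx sum.distrib) (simp add: ep_def if_distrib if_distribR cong: if_cong)
  also have "\<dots> = normal_vec z (\<lambda>j. ?d j (ep l) + (om z)\<^sup>2 * (v l z * x j z))
      + helicoid_deriv lam z (0, - ((om z)\<^sup>2 * v l z))"
  proof -
    have "(\<Sum>j\<in>UNIV. x j z * ((om z)\<^sup>2 * (v l z * x j z))) = (om z)\<^sup>2 * v l z * (w z - 1)"
      unfolding w_def by (simp add: sum_distrib_left mult_ac)
    also have "\<dots> = ((om z)\<^sup>2 * w z) * v l z - (om z)\<^sup>2 * v l z" by (simp add: algebra_simps)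
    finally have "(\<Sum>j\<in>UNIV. x j z * ((om z)\<^sup>2 * (v l z * x j z))) = v l z - (om z)\<^sup>2 * v l z"
      unfolding om by simp
    then show ?thesis
      by (simp add: normal_vec_def helicoid_deriv_def vec_eq_iff distrib_left sum.distrib)
        (simp add: E_def x_def algebra_simps)
  qed
  finally have eq: "frechet_derivative V (at z) (ep l) - normal_vec z (\<lambda>j. ?d j (ep l) + (om z)\<^sup>2 * (v l z * x j z))
    = helicoid_deriv lam z (0, - ((om z)\<^sup>2 * v l z))" by simp
  have "helicoid_deriv lam z h \<in> (normal_subspace (helicoid lam) z)\<^sup>\<bottom>" for h
    using orthogonal_comp_subset[of "tangent_space (helicoid lam) z"]
    by (auto simp: normal_subspace_def tangent_space_def frechet_derivative_helicoid)
  then show ?thesis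
    unfolding normal_deriv_def
    by (intro orth_proj_unique subspace_normal_subspace normal_vec_in) (simp only: eq)
qed

text \<open>Pairing with a normal vector makes the projection invisible, and the acceleration term
  with \<open>(lam $ j)\<^sup>2\<close> points along \<open>E j z\<close>, orthogonal to V.\<close>

lemma second_form_inner:
  "second_form (helicoid lam) z h h' \<bullet> V z = (\<Sum>j\<in>UNIV. lam $ j * (snd h * fst h' $ j + snd h' * fst h $ j) * v j z)"
proof -
  let ?N = "normal_subspace (helicoid lam) z" and ?d = "helicoid_deriv2 lam z h h'"
  have "V z \<in> ?N" using nV unfolding normal_field_def by (rule spec)
  then have "(?d - orth_proj ?N ?d) \<bullet> V z = 0"
    using orth_proj_works(2)[of ?N ?d, OF subspace_normal_subspace]
    unfolding orthogonal_comp_def orthogonal_def by (simp add: inner_commute)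
  then have "second_form (helicoid lam) z h h' \<bullet> V z = ?d \<bullet> V z"
    unfolding second_form_def frechet_derivative2_helicoid by (simp add: inner_diff_left)
  also have "\<dots> = (\<Sum>j\<in>UNIV. ((of_real (- ((lam $ j)\<^sup>2 * snd h * snd h' * fst z $ j))
       + \<i> * of_real (lam $ j * (snd h * fst h' $ j + snd h' * fst h $ j))) * E j z) \<bullet>
        ((of_real 0 + \<i> * of_real (v j z)) * E j z))"
  proof -
    have d: "?d = ((\<chi> j. (of_real (- ((lam $ j)\<^sup>2 * snd h * snd h' * fst z $ j))
       + \<i> * of_real (lam $ j * (snd h * fst h' $ j + snd h' * fst h $ j))) * E j z), 0)"
      unfolding helicoid_deriv2_def E_def by (simp only: of_real_minus uminus_add_conv_diff)
    have V: "V z = ((\<chi> j. (of_real 0 + \<i> * of_real (v j z)) * E j z), - (\<Sum>j\<in>UNIV. x j z * v j z))"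
      using V_eq[of z] unfolding normal_vec_def by (simp only: of_real_0 add_0_left)
    show ?thesis
      unfolding d V inner_prod_def inner_vec_def by (simp only: fst_conv snd_conv vec_lambda_beta inner_zero_left add_0_right)
  qed
  finally show ?thesis unfolding inner_E by simp
qed

definition "frame z a = (fst a, snd a * om z)" for a :: "(real ^ 'k) \<times> real"

lemma frame: "tangent_frame (helicoid lam) z (frame z)"
  unfolding tangent_frame_def frechet_derivative_helicoid inner_helicoid_deriv
proof (intro ballI)
  fix a b :: "(real ^ 'k) \<times> real" assume ab: "a \<in> Basis" "b \<in> Basis"
  have "fst (frame z a) \<bullet> fst (frame z b) + (1 + (\<Sum>j\<in>UNIV. (lam $ j * fst z $ j)\<^sup>2)) * snd (frame z a) * snd (frame z b)
    = fst a \<bullet> fst b + ((om z)\<^sup>2 * w z) * snd a * snd b"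
    by (simp add: frame_def w_def x_def power2_eq_square algebra_simps)
  also have "\<dots> = a \<bullet> b" unfolding om by (simp add: inner_prod_def)
  finally show "fst (frame z a) \<bullet> fst (frame z b) + (1 + (\<Sum>j\<in>UNIV. (lam $ j * fst z $ j)\<^sup>2)) * snd (frame z a) * snd (frame z b)
    = (if a = b then 1 else 0)"
    using ab by (simp add: inner_Basis)
qed

text \<open>The u_l-direction is \<open>lam $ l\<close> times \<open>ep l\<close>. In the curvature
  term only pairs of one u-direction with the s-direction survive; each occurs in both orders, hence
  the factor 2.\<close>

lemma integrand_eq:
  "second_variation_integrand (helicoid lam) V z (frame z)
   = (\<Sum>l\<in>UNIV. (lam $ l)\<^sup>2 * (norm (normal_deriv (helicoid lam) V z (ep l)))\<^sup>2)
     + (norm (normal_deriv (helicoid lam) V z (0, om z)))\<^sup>2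
     - 2 * (om z)\<^sup>2 * (\<Sum>j\<in>UNIV. (lam $ j)\<^sup>2 * (v j z)\<^sup>2)"
proof -
  let ?n = "normal_deriv (helicoid lam) V z"
  have "?n (axis l 1, 0) = lam $ l *\<^sub>R ?n (ep l)" for l
  proof -
    have "(axis l 1, 0) = lam $ l *\<^sub>R ep l"
      using lam[of l] by (simp add: ep_def axis_def vec_eq_iff)
    then show ?thesis using linear_cmul[OF linear_normal_deriv[OF sV]] by metis
  qed
  then have 1: "(\<Sum>a\<in>Basis. (norm (?n (frame z a)))\<^sup>2)
    = (\<Sum>l\<in>UNIV. (lam $ l)\<^sup>2 * (norm (?n (ep l)))\<^sup>2) + (norm (?n (0, om z)))\<^sup>2"
    unfolding sum_Basis_vec_prod_real by (simp add: frame_def power_mult_distrib)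
  have ax: "(\<Sum>j\<in>UNIV. lam $ j * (c * axis i 1 $ j) * v j z) = lam $ i * c * v i z" for i c
    by (simp add: axis_def if_distrib if_distribR cong: if_cong)
  have 2: "(\<Sum>a\<in>Basis. \<Sum>b\<in>Basis. (second_form (helicoid lam) z (frame z a) (frame z b) \<bullet> V z)\<^sup>2)
    = 2 * (om z)\<^sup>2 * (\<Sum>j\<in>UNIV. (lam $ j)\<^sup>2 * (v j z)\<^sup>2)"
    unfolding sum_Basis_vec_prod_real second_form_inner
    by (simp add: frame_def ax) (simp add: power_mult_distrib sum_distrib_left mult_ac)
  show ?thesis unfolding second_variation_integrand_def 1 2 by simp
qed

text \<open>The integrand dominates \<open>mn\<^sup>2 * D z\<close> pointwise: the s-derivative is
  discarded, \<open>mn\<close> bounds the factors in the gradient term from below, and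
  \<open>mx\<close> bounds those in the curvature term from above.\<close>

lemma second_variation_nonneg:
  assumes K: "CARD('k) \<ge> 3" and cV: "compact (closure {z. V z \<noteq> 0})"
    and mn: "0 \<le> mn" "\<And>j. mn \<le> lam $ j" and mx: "\<And>j. lam $ j \<le> mx"
    and le: "8 * mx\<^sup>2 \<le> ((real CARD('k) - 1)\<^sup>2 + 4) * mn\<^sup>2"
  shows "second_variation (helicoid lam) V \<ge> 0"
proof -
  define X where "X z = (\<chi> j. x j z)" for z
  define U where "U z = (\<chi> j. v j z)" for z
  define y where "y z = (\<chi> l j. frechet_derivative (v j) (at z) (ep l)) + (om z)\<^sup>2 *\<^sub>R outer (U z) (X z)" for z
  have v0: "v j z = 0" if "z \<notin> closure {z. V z \<noteq> 0}" for j z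
  proof -
    have "V z = 0" using that closure_subset[of "{z. V z \<noteq> 0}"] by blast
    then show ?thesis by (simp add: v_def)
  qed
  note hardy = hardy_fields.weighted_hardy[OF hardy_fields.intro[of x v om ep, OF smooths(1,4,3) dx dom] K om(1)
      om(2)[unfolded w_def] cV v0, folded X_def U_def, folded y_def]
  obtain D where D: "integrable lborel D" "integral\<^sup>L lborel D = 0"
    "\<And>z. D z \<le> (y z \<bullet> y z + (y z *v X z) \<bullet> (y z *v X z)) / om z
      - (((real CARD('k) - 1) / 2)\<^sup>2 + 1) * om z * (U z \<bullet> U z)"
    by (rule hardy; (assumption | (rule that; assumption)))
  have nd: "(\<Sum>l\<in>UNIV. (norm (normal_deriv (helicoid lam) V z (ep l)))\<^sup>2)
     = y z \<bullet> y z + (y z *v X z) \<bullet> (y z *v X z)" for z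
    unfolding power2_norm_eq_inner normal_deriv_eq inner_normal_vec
    by (simp add: y_def U_def X_def outer_def inner_vec_def matrix_vector_mult_def sum.distrib mult.commute)
  let ?I = "\<lambda>z. second_variation_integrand (helicoid lam) V z (SOME e. tangent_frame (helicoid lam) z e)
     * sqrt (gram_det (helicoid lam) z)"
  have ge: "mn\<^sup>2 * D z \<le> ?I z" for z
  proof -
    let ?n = "\<lambda>l. (norm (normal_deriv (helicoid lam) V z (ep l)))\<^sup>2"
    have "tangent_frame (helicoid lam) z (SOME e. tangent_frame (helicoid lam) z e)"
      using frame[of z] by (intro someI_ex[of "tangent_frame (helicoid lam) z"]) blast
    from second_variation_integrand_frame_indep[OF smooth_helicoid sV immersion_helicoid this frame]
    have I: "?I z = second_variation_integrand (helicoid lam) V z (frame z) / om z"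
      unfolding gram_det_helicoid using om(3)[of z] by (simp add: w_def x_def power2_eq_square)
    have a: "mn\<^sup>2 * (\<Sum>l\<in>UNIV. ?n l) \<le> (\<Sum>l\<in>UNIV. (lam $ l)\<^sup>2 * ?n l)"
      unfolding sum_distrib_left using mn by (intro sum_mono mult_right_mono power_mono) auto
    have b: "(\<Sum>j\<in>UNIV. (lam $ j)\<^sup>2 * (v j z)\<^sup>2) \<le> mx\<^sup>2 * (U z \<bullet> U z)"
    proof -
      have "(\<Sum>j\<in>UNIV. (lam $ j)\<^sup>2 * (v j z)\<^sup>2) \<le> (\<Sum>j\<in>UNIV. mx\<^sup>2 * (v j z)\<^sup>2)"
        using mx lam by (intro sum_mono mult_right_mono power_mono less_imp_le[OF lam]) auto
      then show ?thesis by (simp add: U_def inner_vec_def sum_distrib_left power2_eq_square[of "v _ z"])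
    qed
    let ?m = "((real CARD('k) - 1) / 2)\<^sup>2 + 1"
    \<comment> \<open>A quarter of the hypothesis: the curvature factor 2 against the Hardy constant
      (k - 1)^2 / 4 + 1.\<close>
    have "2 * mx\<^sup>2 \<le> ?m * mn\<^sup>2" using le by (simp add: power_divide algebra_simps)
    from mult_right_mono[OF this, of "U z \<bullet> U z"] b
    have c: "2 * (\<Sum>j\<in>UNIV. (lam $ j)\<^sup>2 * (v j z)\<^sup>2) \<le> mn\<^sup>2 * (?m * (U z \<bullet> U z))"
      by (simp add: mult_ac)
    have "mn\<^sup>2 * D z \<le> mn\<^sup>2 * ((\<Sum>l\<in>UNIV. ?n l) / om z - ?m * om z * (U z \<bullet> U z))"
      using D(3)[of z] unfolding nd by (intro mult_left_mono) auto
    also have "\<dots> = (mn\<^sup>2 * (\<Sum>l\<in>UNIV. ?n l) - (om z)\<^sup>2 * (mn\<^sup>2 * (?m * (U z \<bullet> U z)))) / om z"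
      using om(1)[of z] by (simp add: field_simps power2_eq_square)
    also have "\<dots> \<le> second_variation_integrand (helicoid lam) V z (frame z) / om z"
    proof (rule divide_right_mono)
      show "mn\<^sup>2 * (\<Sum>l\<in>UNIV. ?n l) - (om z)\<^sup>2 * (mn\<^sup>2 * (?m * (U z \<bullet> U z)))
        \<le> second_variation_integrand (helicoid lam) V z (frame z)"
      proof -
        have "2 * (om z)\<^sup>2 * (\<Sum>j\<in>UNIV. (lam $ j)\<^sup>2 * (v j z)\<^sup>2) \<le> (om z)\<^sup>2 * (mn\<^sup>2 * (?m * (U z \<bullet> U z)))"
          using mult_left_mono[OF c, of "(om z)\<^sup>2"] by (simp only: mult_ac zero_le_power2 simp_thms)
        then show ?thesis
          unfolding integrand_eq using a zero_le_power2[of "norm (normal_deriv (helicoid lam) V z (0, om z))"]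
          by linarith
      qed
    qed (use om(1)[of z] in simp)
    finally show ?thesis unfolding I .
  qed
  show ?thesis
  proof (cases "integrable lborel ?I")
    case True
    have "integral\<^sup>L lborel (\<lambda>z. mn\<^sup>2 * D z) \<le> integral\<^sup>L lborel ?I"
      by (rule integral_mono[OF _ True ge]) (simp add: D(1))
    then show ?thesis by (simp add: second_variation_def D(2))
  next
    case False
    \<comment> \<open>The Bochner integral of a non-integrable function is \<open>0\<close>.\<close>
    then show ?thesis by (simp add: second_variation_def not_integrable_integral_eq)
  qed
qed

end

theorem corollary7p2:
  fixes lam :: "real ^ 'k"
  assumes "CARD('k) \<ge> 3"
    and "\<And>j. lam $ j > 0"
    and "8 * (Max (range (\<lambda>j. lam $ j)))\<^sup>2
           \<le> ((real CARD('k) - 1)\<^sup>2 + 4) * (Min (range (\<lambda>j. lam $ j)))\<^sup>2"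
  shows "stable_immersion (helicoid lam)"
  unfolding stable_immersion_def
proof (intro allI impI, elim conjE)
  fix V assume V: "smooth V" "compact (closure {z. V z \<noteq> 0})" "normal_field (helicoid lam) V"
  have "Min (range (\<lambda>j. lam $ j)) \<in> range (\<lambda>j. lam $ j)" by (intro Min_in) auto
  then have "0 \<le> Min (range (\<lambda>j. lam $ j))" using assms(2) by (auto intro: less_imp_le)
  moreover have "helicoid_normal_field lam V"
    using assms(2) V(1,3) by (rule helicoid_normal_field.intro)
  ultimately show "0 \<le> second_variation (helicoid lam) V"
    using V(2) assms by (intro helicoid_normal_field.second_variation_nonneg[where mn = "Min (range (\<lambda>j. lam $ j))"
      and mx = "Max (range (\<lambda>j. lam $ j))"]) auto
qed

end
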